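(* Let $\nu\ge-\tfrac14$ and $x\in\mathbb{C}\setminus(-\infty,0]$. Then $$\int_0^\infty a^2\,J_{2\nu}(ax)\,J_{\nu-1/2}(a^2)\,da=\frac{x}{4}\,J_{\nu+1/2}\left(\frac{x^2}{4}\right).$$
   Context: $J_\nu$ is the Bessel function of the first kind of order $\nu$.
   Formalization: For non-real x the integral diverges and is read as the limit as ε→0+ of the integral with factor exp(-εa²); for Re x ≤ 0, J_{ν+1/2}(x²/4) is taken on the branch arg(x²)=2 arg x, as the principal branch fails (e.g. ν=0); for x>0 the statement is literal. *)

theory Defs
  imports "HOL-Analysis.Analysis"
begin

text \<open>The single-valued factor of the Bessel function: \<open>J\<^sub>\<nu>(z) = (z/2)\<^sup>\<nu> * bessel_J_entire \<nu> z\<close>.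
  \<open>rGamma\<close> is the entire function 1/Gamma, so no order \<open>\<nu>\<close> has to be excluded.\<close>

definition bessel_J_entire :: "complex \<Rightarrow> complex \<Rightarrow> complex" where
  "bessel_J_entire \<nu> z =
     (\<Sum>m. (-1) ^ m * rGamma (of_nat m + \<nu> + 1) / fact m * (z / 2) ^ (2 * m))"

text \<open>Bessel function of the first kind, principal branch. The value at 0 is set separately because
  \<open>0 powr 0 = 0\<close> in the library, whereas \<open>J\<^sub>0(0) = 1\<close>.\<close>

definition bessel_J :: "complex \<Rightarrow> complex \<Rightarrow> complex" where
  "bessel_J \<nu> z =
     (if z = 0 then of_bool (\<nu> = 0) else (z / 2) powr \<nu> * bessel_J_entire \<nu> z)"

text \<open>The same function on the Riemann surface of the logarithm: \<open>bessel_J_log \<nu> w\<close> is the value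
  at the point \<open>exp w\<close> with argument \<open>Im w\<close>, not reduced modulo \<open>2\<pi>\<close>.\<close>

definition bessel_J_log :: "complex \<Rightarrow> complex \<Rightarrow> complex" where
  "bessel_J_log \<nu> w = exp (\<nu> * (w - Ln 2)) * bessel_J_entire \<nu> (exp w)"

lemma bessel_J_eq_log: "z \<noteq> 0 \<Longrightarrow> bessel_J \<nu> z = bessel_J_log \<nu> (Ln z)"
proof -
  assume "z \<noteq> 0"
  then have "Ln (z / 2) = Ln z - Ln 2"
    using Ln_divide_of_real[of 2 z] Ln_of_real[of 2] by simp
  with \<open>z \<noteq> 0\<close> show ?thesis
    unfolding bessel_J_def bessel_J_log_def powr_def by simp
qed

text \<open>Value of the integral of \<open>f\<close> over \<open>[0, \<infinity>)\<close> with Gaussian Abel regularisation. The factor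
  \<open>exp (- \<epsilon> * a\<^sup>2)\<close>, unlike \<open>exp (- \<epsilon> * a)\<close>, dominates integrands of exponential growth.\<close>

definition has_Abel_integral :: "(real \<Rightarrow> complex) \<Rightarrow> complex \<Rightarrow> bool" where
  "has_Abel_integral f I \<longleftrightarrow>
     (\<forall>\<epsilon>>0. (\<lambda>a. of_real (exp (- \<epsilon> * a ^ 2)) * f a) absolutely_integrable_on {0..}) \<and>
     ((\<lambda>\<epsilon>. integral {0..} (\<lambda>a. of_real (exp (- \<epsilon> * a ^ 2)) * f a)) \<longlongrightarrow> I) (at_right 0)"

end

theory Submission
  imports Defs "HOL-Complex_Analysis.Complex_Analysis"
begin

text \<open>For \<open>\<epsilon> > 0\<close> expand \<open>J\<^bsub>2\<nu>\<^esub>(a x)\<close> in powers of \<open>x\<close> and integrate termwise: the \<open>m\<close>-th term is a multiple of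
  the \<open>m\<close>-th derivative at \<open>\<epsilon>\<close> of \<open>G(p) = \<integral> exp (- p * a\<^sup>2) * a\<^bsup>2\<nu>+2\<^esup> * J\<^bsub>\<nu>-1/2\<^esub>(a\<^sup>2) da\<close>. Termwise integration
  for large real \<open>p\<close> and analytic continuation give \<open>G(p) = K * p * (1 + p\<^sup>2) powr (- \<nu> - 1)\<close>, which
  is holomorphic near \<open>p = 0\<close>. By Cauchy's estimates one may let \<open>\<epsilon> \<rightarrow> 0\<close> under the sum, and the
  binomial series of \<open>G\<close> at 0 together with the duplication formula yields the right-hand side.
  For real \<open>x\<close> the improper integral converges by two integrations by parts, based on Bessel's equation,
  and an Abelian argument identifies its value with the regularised one.\<close>

subsection \<open>Power series\<close>

text \<open>For real x > 0 the integrand has size about a^(1/2), and for non-real x it grows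
  exponentially. So \<epsilon> cannot tend to 0 under the integral sign by domination. It can after
  the integration, because G continues across the imaginary axis: its branch points i and -i lie at
  distance 1 from 0, so circles of one fixed radius control all derivatives near 0. As G is odd,
  only odd m survive at p = 0. This leaves x^2 times a series in x^4 and, after duplication, the
  order \<nu> + 1/2. Two kinds of bound are needed. The power series gives exponential majorants,
  good enough for termwise integration; for J(a^2) such a majorant is Gaussian, which is why G is
  computed at large p first. Bessel's equation gives boundedness of sqrt t * J(t), which makes G
  available for all Re p > 0. The hypothesis on \<nu> enters as 4 \<nu> + 1 >= 0, keeping the kernel
  bounded at 0, and as \<nu> + 1/2 >= 1/4 in the Gamma estimates.\<close>

lemma rGamma_div_fact_le:
  fixes s :: real
  assumes "s \<ge> 1/4"
  shows "0 \<le> rGamma (real k + s) \<and> rGamma (real k + s) / fact k \<le> rGamma s * 9 ^ k / fact (2 * k)"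
proof (induction k)
  case 0
  have "Gamma s > 0" using assms by (intro Gamma_real_pos) auto
  then show ?case by (simp add: rGamma_inverse_Gamma)
next
  case (Suc k)
  have pos: "real k + s > 0" using assms by simp
  have rec: "rGamma (real (Suc k) + s) = rGamma (real k + s) / (real k + s)"
    using rGamma_plus1[of "real k + s"] pos by (simp add: field_simps)
  have "rGamma (real (Suc k) + s) / fact (Suc k)
      = (rGamma (real k + s) / fact k) * (1 / ((real k + s) * (real k + 1)))"
    unfolding rec by (simp add: field_simps)
  \<comment> \<open>At k = 0 and s = 1/4 the constant has to be at least 8. The next square is 9, so
    that 9^k = 3^(2k) produces terms of \<open>exp (3 * z)\<close>.\<close>
  also have "\<dots> \<le> (rGamma s * 9 ^ k / fact (2 * k)) * (9 / ((2 * real k + 2) * (2 * real k + 1)))"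
  proof (intro mult_mono)
    show "1 / ((real k + s) * (real k + 1)) \<le> 9 / ((2 * real k + 2) * (2 * real k + 1))"
    proof -
      have "2 * (2 * real k + 1) \<le> 9 * (real k + s)" using assms by simp
      then have "2 * (2 * real k + 1) * (real k + 1) \<le> 9 * (real k + s) * (real k + 1)"
        by (intro mult_right_mono) auto
      then have le: "(2 * real k + 2) * (2 * real k + 1) \<le> 9 * ((real k + s) * (real k + 1))"
        by (simp add: algebra_simps)
      have "1 / A \<le> 9 / B" if "A > 0" "B > 0" "B \<le> 9 * A" for A B :: real
        using that by (simp add: field_simps)
      from this[OF _ _ le] show ?thesis using pos by simp
    qed
  qed (use Suc pos in \<open>auto intro!: divide_nonneg_nonneg order_trans[OF _ conjunct2[OF Suc]]\<close>)
  also have "\<dots> = rGamma s * 9 ^ Suc k / fact (2 * Suc k)"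
  proof -
    have "fact (2 * Suc k) = (2 * real k + 2) * (2 * real k + 1) * fact (2 * k)"
      by (simp add: algebra_simps)
    then show ?thesis by (simp add: field_simps)
  qed
  finally show ?case using Suc pos unfolding rec by simp
qed

text \<open>The majorants 9^m / (2m)! give the even terms of the series of
  \<open>exp (3 * z)\<close>. All exponential bounds on Bessel series below come from this
  sum.\<close>

lemma sum_rGamma_le:
  fixes s z :: real
  assumes "s \<ge> 1/4" "z \<ge> 0"
  shows "(\<Sum>m<n. rGamma (real m + s) / fact m * (z\<^sup>2) ^ m) \<le> rGamma s * exp (3 * z)"
proof -
  have r: "rGamma s \<ge> 0" using rGamma_div_fact_le[OF assms(1), of 0] by simp
  have "(\<Sum>m<n. rGamma (real m + s) / fact m * (z\<^sup>2) ^ m)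
      \<le> (\<Sum>m<n. rGamma s * 9 ^ m / fact (2 * m) * (z\<^sup>2) ^ m)"
    using rGamma_div_fact_le[OF assms(1)] assms(2) by (intro sum_mono mult_right_mono) auto
  also have "\<dots> = rGamma s * (\<Sum>m<n. (3 * z) ^ (2 * m) / fact (2 * m))"
    by (simp add: sum_distrib_left power_mult power_mult_distrib mult.assoc)
  also have "(\<Sum>m<n. (3 * z) ^ (2 * m) / fact (2 * m)) = (\<Sum>k\<in>(*) 2 ` {..<n}. (3 * z) ^ k / fact k)"
    by (subst sum.reindex) (auto simp: inj_on_def)
  also have "\<dots> \<le> (\<Sum>k. (3 * z) ^ k / fact k)"
    using assms(2) summable_exp_generic[of "3 * z"]
    by (intro sum_le_suminf) (auto simp: field_simps)
  also have "\<dots> = exp (3 * z)"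
    by (simp add: exp_def field_simps)
  finally show ?thesis using r by (simp add: mult_left_mono)
qed

lemma rGamma_series_summable:
  fixes s y :: real
  assumes "s \<ge> 1/4"
  shows "summable (\<lambda>m. norm ((-1) ^ m * rGamma (real m + s) / fact m * y ^ m))"
proof (rule summableI_nonneg_bounded)
  fix n
  have "(\<Sum>m<n. norm ((-1) ^ m * rGamma (real m + s) / fact m * y ^ m))
      = (\<Sum>m<n. rGamma (real m + s) / fact m * ((sqrt \<bar>y\<bar>)\<^sup>2) ^ m)"
    using rGamma_div_fact_le[OF assms] by (intro sum.cong) (auto simp: abs_mult power_abs)
  also have "\<dots> \<le> rGamma s * exp (3 * sqrt \<bar>y\<bar>)"
    by (rule sum_rGamma_le) (use assms in auto)
  finally show "(\<Sum>m<n. norm ((-1) ^ m * rGamma (real m + s) / fact m * y ^ m)) \<le> rGamma s * exp (3 * sqrt \<bar>y\<bar>)" .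
qed auto

text \<open>\<open>J\<^sub>s(t) = (t / 2)\<^sup>s * bessel_red s (t\<^sup>2 / 4)\<close>.\<close>

definition bessel_red :: "real \<Rightarrow> real \<Rightarrow> real" where
  "bessel_red s y = (\<Sum>m. (-1) ^ m * rGamma (real m + s + 1) / fact m * y ^ m)"

lemma bessel_red_sums:
  assumes "s \<ge> - 3/4"
  shows "(\<lambda>m. (-1) ^ m * rGamma (real m + s + 1) / fact m * y ^ m) sums bessel_red s y"
  unfolding bessel_red_def using rGamma_series_summable[of "s+1" y] assms
  by (intro summable_sums) (auto intro: summable_norm_cancel simp: add_ac)

lemma has_field_derivative_bessel_red:
  assumes "s \<ge> - 3/4"
  shows "(bessel_red s has_field_derivative - bessel_red (s + 1) y) (at y)"
proof -
  let ?c = "\<lambda>m. (-1) ^ m * rGamma (real m + s + 1) / fact m"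
  have "((\<lambda>x. \<Sum>n. ?c n * x ^ n) has_field_derivative (\<Sum>n. diffs ?c n * y ^ n)) (at y)"
    using bessel_red_sums[OF assms] by (intro termdiffs_strong_converges_everywhere) (auto simp: sums_iff)
  moreover have "(\<Sum>n. diffs ?c n * y ^ n) = - bessel_red (s + 1) y"
  proof -
    have "diffs ?c n * y ^ n = - ((-1) ^ n * rGamma (real n + (s + 1) + 1) / fact n * y ^ n)" for n
    proof -
      have "real n + (s + 1) + 1 = real (Suc n) + s + 1" by simp
      then show ?thesis
        unfolding diffs_def fact_Suc power_Suc by (simp only: of_nat_mult) (simp del: of_nat_Suc)
    qed
    then show ?thesis using bessel_red_sums[of "s+1" y] assms by (simp add: sums_iff suminf_minus)
  qed
  ultimately show ?thesis by (simp add: bessel_red_def[abs_def])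
qed

text \<open>The three-term relation J_s + J_(s+2) = (2 (s + 1) / t) J_(s+1) in reduced form,
  obtained by comparing coefficients. It later removes the order s + 2 from the second derivative of
  \<open>bessel_u\<close>.\<close>

lemma bessel_red_recurrence:
  assumes "s \<ge> - 3/4"
  shows "y * bessel_red (s + 2) y = (s + 1) * bessel_red (s + 1) y - bessel_red s y"
proof -
  let ?a = "\<lambda>s m. (-1) ^ m * rGamma (real m + s + 1) / fact m * y ^ m"
  have 2: "?a (s + 2) sums bessel_red (s + 2) y" and 1: "?a (s + 1) sums bessel_red (s + 1) y"
    and 0: "?a s sums bessel_red s y"
    by (rule bessel_red_sums, use assms in simp)+
  have "(\<lambda>m. (s + 1) * ?a (s + 1) m - ?a s m) sums ((s + 1) * bessel_red (s + 1) y - bessel_red s y)"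
    by (intro sums_diff sums_mult 1 0)
  \<comment> \<open>The factor y on the left shifts the index by one. The coefficient at index 0 on
    the right vanishes by the functional equation of Gamma.\<close>
  moreover have "(\<lambda>m. (s + 1) * ?a (s + 1) (Suc m) - ?a s (Suc m)) sums (y * bessel_red (s + 2) y)"
  proof -
    have "(s + 1) * ?a (s + 1) (Suc m) - ?a s (Suc m) = y * ?a (s + 2) m" for m
    proof -
      have "rGamma (real (Suc m) + s + 1) = (real m + s + 2) * rGamma (real m + s + 2 + 1)"
        using rGamma_plus1[of "real m + s + 2"] by (simp add: add_ac)
      moreover have "rGamma (real (Suc m) + (s + 1) + 1) = rGamma (real m + s + 2 + 1)"
        "rGamma (real m + (s + 2) + 1) = rGamma (real m + s + 2 + 1)"
        by (simp_all add: algebra_simps)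
      moreover have "(s + 1) * (- 1 * e * R / (N * F) * (y * Y)) - - 1 * e * ((N + s + 1) * R) / (N * F) * (y * Y)
          = y * (e * R / F * Y)" if "N > 0" "F > 0" for e R N F Y :: real
        using that by (simp add: field_simps)
      from this[of "1 + real m" "fact m" "(- 1) ^ m" "rGamma (real m + s + 2 + 1)" "y ^ m"]
      have "(s + 1) * (- 1 * (- 1) ^ m * rGamma (real m + s + 2 + 1) / ((1 + real m) * fact m) * (y * y ^ m))
          - - 1 * (- 1) ^ m * ((real m + s + 2) * rGamma (real m + s + 2 + 1)) / ((1 + real m) * fact m) * (y * y ^ m)
          = y * ((- 1) ^ m * rGamma (real m + s + 2 + 1) / fact m * y ^ m)"
        by (simp add: add_ac)
      ultimately show ?thesis
        by (simp only: fact_Suc power_Suc of_nat_mult of_nat_Suc)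
    qed
    then show ?thesis using sums_mult[OF 2, of y] by simp
  qed
  moreover have "(s + 1) * ?a (s + 1) 0 - ?a s 0 = 0"
    using rGamma_plus1[of "s + 1"] by (simp add: add_ac)
  ultimately show ?thesis
    by (subst (asm) sums_Suc_iff) (auto dest: sums_unique2)
qed

text \<open>The alternating signs are ignored, hence the exponential growth. The true size for large
  arguments comes from Bessel's equation instead.\<close>

lemma bessel_red_bound:
  assumes "s \<ge> - 3/4" "z \<ge> 0"
  shows "\<bar>bessel_red s (z\<^sup>2)\<bar> \<le> rGamma (s + 1) * exp (3 * z)"
proof -
  let ?a = "\<lambda>m. (-1) ^ m * rGamma (real m + s + 1) / fact m * (z\<^sup>2) ^ m"
  have *: "norm (?a m) = rGamma (real m + (s + 1)) / fact m * (z\<^sup>2) ^ m" for m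
    using rGamma_div_fact_le[of "s+1" m] assms by (auto simp: abs_mult add_ac power_abs)
  have "(\<lambda>n. \<Sum>m<n. ?a m) \<longlonglongrightarrow> bessel_red s (z\<^sup>2)"
    using bessel_red_sums[OF assms(1)] by (simp add: sums_def)
  then have "(\<lambda>n. norm (\<Sum>m<n. ?a m)) \<longlonglongrightarrow> norm (bessel_red s (z\<^sup>2))"
    by (rule tendsto_norm)
  moreover have "norm (\<Sum>m<n. ?a m) \<le> rGamma (s + 1) * exp (3 * z)" for n
  proof -
    have "norm (\<Sum>m<n. ?a m) \<le> (\<Sum>m<n. norm (?a m))" by (rule norm_sum)
    also have "\<dots> \<le> rGamma (s + 1) * exp (3 * z)"
      unfolding * by (rule sum_rGamma_le) (use assms in auto)
    finally show ?thesis .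
  qed
  ultimately show ?thesis by (intro LIMSEQ_le_const2[where X="\<lambda>n. norm (\<Sum>m<n. ?a m)", simplified]) auto
qed

subsection \<open>Bounds from Bessel's equation\<close>

text \<open>\<open>bessel_u s t = 2\<^sup>s * sqrt t * J\<^sub>s(t)\<close> and its derivative.\<close>

definition bessel_u :: "real \<Rightarrow> real \<Rightarrow> real" where
  "bessel_u s t = t powr (s + 1/2) * bessel_red s (t\<^sup>2 / 4)"

definition bessel_u' :: "real \<Rightarrow> real \<Rightarrow> real" where
  "bessel_u' s t = t powr (s + 1/2) * ((s + 1/2) / t * bessel_red s (t\<^sup>2 / 4) - t / 2 * bessel_red (s + 1) (t\<^sup>2 / 4))"

lemma powr_has_field_derivative_self:
  fixes t s :: real
  assumes "t > 0"
  shows "((\<lambda>t. t powr s) has_field_derivative s * t powr s / t) (at t)"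
  using assms by (auto intro!: derivative_eq_intros simp: powr_diff)

lemma bessel_red_sq_deriv:
  assumes "s \<ge> - 3/4"
  shows "((\<lambda>t. bessel_red s (t\<^sup>2 / 4)) has_field_derivative - t / 2 * bessel_red (s + 1) (t\<^sup>2 / 4)) (at t)"
proof -
  have "((\<lambda>t::real. t\<^sup>2 / 4) has_field_derivative t / 2) (at t)"
    by (auto intro!: derivative_eq_intros)
  from DERIV_chain2[OF has_field_derivative_bessel_red[OF assms] this] show ?thesis
    by (simp add: mult_ac)
qed

lemma bessel_u_deriv:
  assumes "s \<ge> - 3/4" "t > 0"
  shows "(bessel_u s has_field_derivative bessel_u' s t) (at t)"
proof -
  have "((\<lambda>t. t powr (s + 1/2) * bessel_red s (t\<^sup>2 / 4)) has_field_derivative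
     (s + 1/2) * t powr (s + 1/2) / t * bessel_red s (t\<^sup>2 / 4)
       + (- t / 2 * bessel_red (s + 1) (t\<^sup>2 / 4)) * t powr (s + 1/2)) (at t)"
    by (rule DERIV_mult powr_has_field_derivative_self assms bessel_red_sq_deriv)+
  then show ?thesis
    unfolding bessel_u_def[abs_def] bessel_u'_def by (rule DERIV_cong) (simp add: algebra_simps)
qed

text \<open>The factor sqrt t removes the first-order term from Bessel's equation. What remains is a
  harmonic oscillator with the perturbation (1/4 - s^2) / t^2, which is integrable at
  infinity.\<close>

lemma bessel_u'_deriv:
  assumes "s \<ge> - 3/4" "t > 0"
  shows "(bessel_u' s has_field_derivative - (1 + (1/4 - s\<^sup>2) / t\<^sup>2) * bessel_u s t) (at t)"
proof -
  define P where "P = t powr (s + 1/2)"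
  define e0 where "e0 = bessel_red s (t\<^sup>2 / 4)"
  define e1 where "e1 = bessel_red (s + 1) (t\<^sup>2 / 4)"
  define e2 where "e2 = bessel_red (s + 2) (t\<^sup>2 / 4)"
  have P: "((\<lambda>t. t powr (s + 1/2)) has_field_derivative (s + 1/2) * P / t) (at t)"
    unfolding P_def by (rule powr_has_field_derivative_self[OF assms(2)])
  have D0: "((\<lambda>t. bessel_red s (t\<^sup>2 / 4)) has_field_derivative - t / 2 * e1) (at t)"
    unfolding e1_def by (rule bessel_red_sq_deriv[OF assms(1)])
  have D1: "((\<lambda>t. bessel_red (s + 1) (t\<^sup>2 / 4)) has_field_derivative - t / 2 * e2) (at t)"
    unfolding e2_def using bessel_red_sq_deriv[of "s + 1" t] assms(1) by (simp add: add.assoc)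
  have rec: "t\<^sup>2 * e2 = 4 * ((s + 1) * e1 - e0)"
    using bessel_red_recurrence[OF assms(1), of "t\<^sup>2 / 4"] by (simp add: e0_def e1_def e2_def)
  define f0 where "f0 = (\<lambda>t. bessel_red s (t\<^sup>2 / 4))"
  define f1 where "f1 = (\<lambda>t. bessel_red (s + 1) (t\<^sup>2 / 4))"
  have D: "(f0 has_field_derivative - t / 2 * e1) (at t)" "(f1 has_field_derivative - t / 2 * e2) (at t)"
    using D0 D1 by (simp_all add: f0_def f1_def)
  have "((\<lambda>t. (s + 1/2) / t * f0 t - t / 2 * f1 t) has_field_derivative
     (- (s + 1/2) / t\<^sup>2 * f0 t + (s + 1/2) / t * (- t / 2 * e1) - 1 / 2 * f1 t - t / 2 * (- t / 2 * e2))) (at t)"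
    using assms(2) by (auto intro!: derivative_eq_intros D simp: power2_eq_square) (simp add: field_simps)
  from DERIV_mult[OF P this]
  have "((\<lambda>t. t powr (s + 1/2) * ((s + 1/2) / t * bessel_red s (t\<^sup>2 / 4) - t / 2 * bessel_red (s + 1) (t\<^sup>2 / 4)))
     has_field_derivative
      (s + 1/2) * P / t * ((s + 1/2) / t * e0 - t / 2 * e1)
      + P * (- (s + 1/2) / t\<^sup>2 * e0 + (s + 1/2) / t * (- t / 2 * e1) - 1 / 2 * e1 - t / 2 * (- t / 2 * e2))) (at t)"
    by (simp only: f0_def f1_def e0_def e1_def P_def mult_ac)
  moreover have "(s + 1/2) * P / t * ((s + 1/2) / t * e0 - t / 2 * e1)
      + P * (- (s + 1/2) / t\<^sup>2 * e0 + (s + 1/2) / t * (- t / 2 * e1) - 1 / 2 * e1 - t / 2 * (- t / 2 * e2))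
      = - (1 + (1/4 - s\<^sup>2) / t\<^sup>2) * (P * e0)"
  proof -
    have "(s + 1/2) * P / t * ((s + 1/2) / t * e0 - t / 2 * e1)
      + P * (- (s + 1/2) / t\<^sup>2 * e0 + (s + 1/2) / t * (- t / 2 * e1) - 1 / 2 * e1 - t / 2 * (- t / 2 * e2))
      = P * ((s\<^sup>2 - 1/4) / t\<^sup>2 * e0 - (s + 1) * e1 + t\<^sup>2 * e2 / 4)"
      using assms(2) by (simp add: field_simps power2_eq_square)
    also have "\<dots> = - (1 + (1/4 - s\<^sup>2) / t\<^sup>2) * (P * e0)"
      unfolding rec using assms(2) by (simp add: field_simps)
    finally show ?thesis .
  qed
  ultimately show ?thesis
    unfolding bessel_u'_def[abs_def] bessel_u_def P_def e0_def by (rule DERIV_cong)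
qed

text \<open>With \<open>c = 1/4 - s\<^sup>2\<close>, the energy \<open>E = u\<^sup>2 + u'\<^sup>2\<close> of a solution of \<open>u'' = - (1 + c / t\<^sup>2) u\<close>
  satisfies \<open>E' \<le> \<bar>c\<bar> E / t\<^sup>2\<close>, so \<open>E exp (\<bar>c\<bar> / t)\<close> is nonincreasing.\<close>

lemma bessel_u_bounded:
  assumes "s \<ge> - 3/4"
  obtains C where "C > 0" "\<And>t. t \<ge> 1 \<Longrightarrow> \<bar>bessel_u s t\<bar> \<le> C" "\<And>t. t \<ge> 1 \<Longrightarrow> \<bar>bessel_u' s t\<bar> \<le> C"
proof -
  define c where "c = 1/4 - s\<^sup>2"
  define E where "E = (\<lambda>t. (bessel_u s t)\<^sup>2 + (bessel_u' s t)\<^sup>2)"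
  have E0: "E t \<ge> 0" for t by (simp add: E_def)
  have le: "E t * exp (\<bar>c\<bar> / t) \<le> E 1 * exp (\<bar>c\<bar> / 1)" if "t \<ge> 1" for t
  proof (rule DERIV_nonpos_imp_nonincreasing[OF that])
    fix y :: real assume y: "1 \<le> y" "y \<le> t"
    then have y0: "y > 0" by simp
    let ?u = "bessel_u s y" and ?v = "bessel_u' s y"
    have D: "((\<lambda>t. E t * exp (\<bar>c\<bar> / t)) has_field_derivative
        exp (\<bar>c\<bar> / y) * (- 2 * c * ?u * ?v - \<bar>c\<bar> * E y) / y\<^sup>2) (at y)"
    proof -
      have "(E has_field_derivative (2 * ?u * ?v + 2 * ?v * (- (1 + c / y\<^sup>2) * ?u))) (at y)"
        unfolding E_def c_def
        by (rule derivative_eq_intros bessel_u_deriv[OF assms y0] bessel_u'_deriv[OF assms y0] | simp)+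
      then have DE: "(E has_field_derivative - 2 * c * ?u * ?v / y\<^sup>2) (at y)"
        by (rule DERIV_cong) (simp add: algebra_simps)
      have DX: "((\<lambda>t. exp (\<bar>c\<bar> / t)) has_field_derivative exp (\<bar>c\<bar> / y) * (- \<bar>c\<bar> / y\<^sup>2)) (at y)"
        using y0 by (auto intro!: derivative_eq_intros simp: power2_eq_square)
      from DERIV_mult[OF DE DX] show ?thesis
        by (rule DERIV_cong) (simp add: diff_divide_distrib right_diff_distrib mult_ac)
    qed
    \<comment> \<open>The oscillator part cancels in the derivative of the energy; only the
      perturbation is left, and 2 |u v| <= u^2 + v^2 bounds it.\<close>
    have "- 2 * c * ?u * ?v \<le> \<bar>c\<bar> * E y"
    proof -
      have "- 2 * c * ?u * ?v \<le> \<bar>c\<bar> * \<bar>2 * ?u * ?v\<bar>"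
        using abs_ge_self[of "- 2 * c * ?u * ?v"] by (simp add: abs_mult mult_ac)
      also have "\<bar>2 * ?u * ?v\<bar> \<le> E y"
        using sum_squares_bound[of "\<bar>?u\<bar>" "\<bar>?v\<bar>"] by (simp add: E_def abs_mult)
      finally show ?thesis by (simp add: mult_left_mono)
    qed
    then have "exp (\<bar>c\<bar> / y) * (- 2 * c * ?u * ?v - \<bar>c\<bar> * E y) / y\<^sup>2 \<le> 0"
      by (intro divide_nonpos_nonneg mult_nonneg_nonpos) auto
    with D show "\<exists>y'. ((\<lambda>t. E t * exp (\<bar>c\<bar> / t)) has_field_derivative y') (at y) \<and> y' \<le> 0" by blast
  qed
  define K where "K = E 1 * exp \<bar>c\<bar>"
  have EK: "E t \<le> K" if "t \<ge> 1" for t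
  proof -
    have "E t * 1 \<le> E t * exp (\<bar>c\<bar> / t)"
      using that E0 by (intro mult_left_mono) auto
    with le[OF that] show ?thesis by (simp add: K_def)
  qed
  show ?thesis
  proof (rule that[of "sqrt K + 1"])
    have "K \<ge> 0" using E0 by (simp add: K_def)
    then show "sqrt K + 1 > 0" by (simp add: add_nonneg_pos)
    fix t :: real assume t: "t \<ge> 1"
    have "\<bar>bessel_u s t\<bar> \<le> sqrt (E t)" "\<bar>bessel_u' s t\<bar> \<le> sqrt (E t)"
      by (auto simp: E_def intro!: real_le_rsqrt)
    moreover have "sqrt (E t) \<le> sqrt K" using EK[OF t] by simp
    ultimately show "\<bar>bessel_u s t\<bar> \<le> sqrt K + 1" "\<bar>bessel_u' s t\<bar> \<le> sqrt K + 1" by linarith+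
  qed
qed

subsection \<open>Gaussian transforms\<close>

lemma borel_measurable_lebesgue_onI:
  "f \<in> borel_measurable borel \<Longrightarrow> f \<in> borel_measurable (lebesgue_on S)"
  by (intro measurable_restrict_space1 measurable_completion) simp

text \<open>This allows derivatives to be read off from a termwise integrated series or from a
  binomial series, without differentiating under the integral sign.\<close>

lemma powser_coeff_unique:
  fixes f :: "complex \<Rightarrow> complex"
  assumes "r > 0"
    and "\<And>w. w \<in> ball z r \<Longrightarrow> (\<lambda>n. c n * (w - z) ^ n) sums f w"
    and "\<And>w. w \<in> ball z r \<Longrightarrow> (\<lambda>n. d n * (w - z) ^ n) sums f w"
  shows "c = d"
proof -
  have *: "e n = (deriv ^^ n) (\<lambda>u. f (z + u)) 0 / fact n"
    if "\<And>w. w \<in> ball z r \<Longrightarrow> (\<lambda>n. e n * (w - z) ^ n) sums f w" for e n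
  proof -
    have "(\<lambda>u. f (z + u)) has_fps_expansion Abs_fps e"
    proof (rule has_fps_expansionI)
      have "eventually (\<lambda>u. u \<in> ball 0 r) (nhds (0::complex))"
        using assms(1) by (intro eventually_nhds_in_open) auto
      then show "eventually (\<lambda>u. (\<lambda>n. fps_nth (Abs_fps e) n * u ^ n) sums f (z + u)) (nhds 0)"
      proof eventually_elim
        case (elim u)
        then show ?case using that[of "z + u"] by (simp add: dist_norm)
      qed
    qed
    from fps_nth_fps_expansion[OF this] show ?thesis by simp
  qed
  show ?thesis using *[OF assms(2)] *[OF assms(3)] by fastforce
qed

text \<open>Dominated convergence of the partial sums, with one majorant \<open>H\<close> for all
  sums of norms. Every termwise integration below goes through this form.\<close>

lemma integral_sums:
  fixes g :: "nat \<Rightarrow> 'n::euclidean_space \<Rightarrow> 'm::euclidean_space"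
  assumes "\<And>m. g m integrable_on S" "H integrable_on S"
    and "\<And>n a. a \<in> S \<Longrightarrow> (\<Sum>m<n. norm (g m a)) \<le> H a"
    and "\<And>a. a \<in> S \<Longrightarrow> (\<lambda>m. g m a) sums h a"
  shows "h integrable_on S" "(\<lambda>m. integral S (g m)) sums integral S h"
proof -
  let ?f = "\<lambda>n a. \<Sum>m<n. g m a"
  have 1: "?f n integrable_on S" for n
    using assms(1) by (intro integrable_sum) auto
  have 2: "norm (?f n a) \<le> H a" if "a \<in> S" for n a
    by (rule order_trans[OF norm_sum assms(3)[OF that]])
  have 3: "(\<lambda>n. ?f n a) \<longlonglongrightarrow> h a" if "a \<in> S" for a
    using assms(4)[OF that] by (simp add: sums_def)
  show "h integrable_on S"
    by (rule dominated_convergence(1)[OF 1 assms(2) 2 3])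
  have "(\<lambda>n. integral S (?f n)) \<longlonglongrightarrow> integral S h"
    by (rule dominated_convergence(2)[OF 1 assms(2) 2 3])
  moreover have "integral S (?f n) = (\<Sum>m<n. integral S (g m))" for n
    using assms(1) by (subst integral_sum) auto
  ultimately show "(\<lambda>m. integral S (g m)) sums integral S h"
    by (simp add: sums_def)
qed

text \<open>Substitute t = p * a^2 in Euler's integral for Gamma.\<close>

lemma gaussian_moment:
  fixes s p :: real
  assumes "s > 0" "p > 0"
  shows "(\<lambda>a. a powr (2 * s - 1) * exp (- p * a\<^sup>2)) absolutely_integrable_on {0..}"
    "integral {0..} (\<lambda>a. a powr (2 * s - 1) * exp (- p * a\<^sup>2)) = Gamma s / (2 * p powr s)"
proof -
  let ?f = "\<lambda>t::real. t powr (s - 1) / exp t"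
  let ?g = "\<lambda>a::real. p * a\<^sup>2"
  have img: "?g ` {0..} = {0..}"
  proof -
    have "t \<in> ?g ` {0..}" if "t \<ge> 0" for t
      using that assms by (intro image_eqI[of _ _ "sqrt (t / p)"]) auto
    then show ?thesis using assms by auto
  qed
  have "?f absolutely_integrable_on {0..}"
    using Gamma_integral_real[OF assms(1)] by (intro nonnegative_absolutely_integrable_1) (auto simp: integrable_on_def)
  moreover have "integral {0..} ?f = Gamma s"
    using Gamma_integral_real[OF assms(1)] by (rule integral_unique)
  ultimately have *: "(\<lambda>a. \<bar>2 * p * a\<bar> *\<^sub>R ?f (?g a)) absolutely_integrable_on {0..} \<and>
      integral {0..} (\<lambda>a. \<bar>2 * p * a\<bar> *\<^sub>R ?f (?g a)) = Gamma s"
    using assms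
    by (subst has_absolute_integral_change_of_variables_real[where g = ?g])
       (auto simp: img inj_on_def intro!: derivative_eq_intros)
  have eq: "\<bar>2 * p * a\<bar> *\<^sub>R ?f (?g a) = (2 * p powr s) * (a powr (2 * s - 1) * exp (- p * a\<^sup>2))"
    if "a \<in> {0..}" for a
  proof (cases "a = 0")
    case False
    then have a: "a > 0" using that by simp
    have "(p * a\<^sup>2) powr (s - 1) = p powr (s - 1) * a powr (2 * s - 2)"
    proof -
      have "a\<^sup>2 = a powr 2" using a by simp
      then have "(a\<^sup>2) powr (s - 1) = a powr (2 * s - 2)"
        by (simp only: powr_powr) (simp add: algebra_simps)
      then show ?thesis using a assms by (simp add: powr_mult)
    qed
    moreover have "p * p powr (s - 1) = p powr s" "a * a powr (2 * s - 2) = a powr (2 * s - 1)"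
      using a assms by (simp_all add: powr_mult_base)
    moreover have "\<bar>2 * p * a\<bar> *\<^sub>R (p * a\<^sup>2) powr (s - 1) = 2 * (p * p powr (s - 1)) * (a * a powr (2 * s - 2))"
      unfolding calculation(1) using a assms by simp
    ultimately show ?thesis using a assms
      by (simp add: exp_minus divide_inverse)
  qed auto
  have pos: "2 * p powr s > 0" using assms by simp
  have I: "(\<lambda>a. (2 * p powr s) * (a powr (2 * s - 1) * exp (- p * a\<^sup>2))) absolutely_integrable_on {0..}"
    "integral {0..} (\<lambda>a. (2 * p powr s) * (a powr (2 * s - 1) * exp (- p * a\<^sup>2))) = Gamma s"
  proof -
    show "(\<lambda>a. (2 * p powr s) * (a powr (2 * s - 1) * exp (- p * a\<^sup>2))) absolutely_integrable_on {0..}"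
      using * by (subst set_integrable_cong[OF refl refl eq[symmetric]]) auto
    show "integral {0..} (\<lambda>a. (2 * p powr s) * (a powr (2 * s - 1) * exp (- p * a\<^sup>2))) = Gamma s"
      using * by (subst integral_cong[OF eq[symmetric]]) auto
  qed
  from I(1) have "(\<lambda>a. 1 / (2 * p powr s) * ((2 * p powr s) * (a powr (2 * s - 1) * exp (- p * a\<^sup>2)))) absolutely_integrable_on {0..}"
    by (rule set_integrable_mult_right)
  then show "(\<lambda>a. a powr (2 * s - 1) * exp (- p * a\<^sup>2)) absolutely_integrable_on {0..}"
    using pos by (simp only: mult.assoc[symmetric]) simp
  show "integral {0..} (\<lambda>a. a powr (2 * s - 1) * exp (- p * a\<^sup>2)) = Gamma s / (2 * p powr s)"
    using I(2) pos by (simp only: integral_mult_right) (simp add: field_simps)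
qed

definition subgaussian :: "(real \<Rightarrow> complex) \<Rightarrow> bool" where
  "subgaussian b \<longleftrightarrow> b \<in> borel_measurable borel \<and>
     (\<forall>d>0. \<exists>C. \<forall>a\<ge>0. norm (b a) \<le> C * exp (d * a\<^sup>2))"

lemma subgaussian_absolutely_integrable:
  assumes "subgaussian b" "Re p > 0"
  shows "(\<lambda>a. exp (- p * of_real (a\<^sup>2)) * b a) absolutely_integrable_on {0..}"
proof -
  obtain C where C: "\<And>a. a \<ge> 0 \<Longrightarrow> norm (b a) \<le> C * exp (Re p / 2 * a\<^sup>2)"
    using assms unfolding subgaussian_def by (meson half_gt_zero)
  have [measurable]: "b \<in> borel_measurable borel" using assms by (simp add: subgaussian_def)
  have "(\<lambda>a. a powr (2 * (1/2) - 1) * exp (- (Re p / 2) * a\<^sup>2)) absolutely_integrable_on {0..}"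
    by (rule gaussian_moment) (use assms in auto)
  then have "(\<lambda>a. C * (a powr (2 * (1/2) - 1) * exp (- (Re p / 2) * a\<^sup>2))) absolutely_integrable_on {0..}"
    by (intro set_integrable_mult_right)
  then have *: "(\<lambda>a. C * (a powr (2 * (1/2) - 1) * exp (- (Re p / 2) * a\<^sup>2))) integrable_on {0..}"
    by (rule set_lebesgue_integral_eq_integral)
  \<comment> \<open>The moment with s = 1/2 contains \<open>a powr 0\<close>, which is 1 except at a
    = 0, where \<open>0 powr 0 = 0\<close>; hence the null set.\<close>
  have "(\<lambda>a. C * exp (- (Re p / 2) * a\<^sup>2)) integrable_on {0..}"
    by (rule integrable_spike[OF *, of "{0}"]) auto
  then show ?thesis
  proof (rule measurable_bounded_by_integrable_imp_absolutely_integrable[rotated 2])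
    show "(\<lambda>a. exp (- p * of_real (a\<^sup>2)) * b a) \<in> borel_measurable (lebesgue_on {0..})"
      by (rule borel_measurable_lebesgue_onI) measurable
    fix a :: real assume "a \<in> {0..}"
    then have "norm (exp (- p * of_real (a\<^sup>2)) * b a) \<le> exp (- Re p * a\<^sup>2) * (C * exp (Re p / 2 * a\<^sup>2))"
      unfolding norm_mult norm_exp_eq_Re using C[of a] by (intro mult_mono) (auto simp del: of_real_power)
    also have "\<dots> = C * exp (- (Re p / 2) * a\<^sup>2)"
      by (simp add: mult_exp_exp algebra_simps)
    finally show "norm (exp (- p * of_real (a\<^sup>2)) * b a) \<le> C * exp (- (Re p / 2) * a\<^sup>2)" .
  qed auto
qed

lemma subgaussian_mult:
  assumes "subgaussian b" "subgaussian c"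
  shows "subgaussian (\<lambda>a. b a * c a)"
  unfolding subgaussian_def
proof (intro conjI allI impI)
  show "(\<lambda>a. b a * c a) \<in> borel_measurable borel"
    using assms unfolding subgaussian_def by (intro borel_measurable_times) auto
  fix d :: real assume "d > 0"
  then have d: "d / 2 > 0" by simp
  obtain C D where CD: "\<And>a. a \<ge> 0 \<Longrightarrow> norm (b a) \<le> C * exp (d / 2 * a\<^sup>2)"
    "\<And>a. a \<ge> 0 \<Longrightarrow> norm (c a) \<le> D * exp (d / 2 * a\<^sup>2)"
    using assms d unfolding subgaussian_def by meson
  have "norm (b a * c a) \<le> C * D * exp (d * a\<^sup>2)" if "a \<ge> 0" for a
  proof -
    have "norm (b a * c a) \<le> (C * exp (d / 2 * a\<^sup>2)) * (D * exp (d / 2 * a\<^sup>2))"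
      unfolding norm_mult by (intro mult_mono CD that norm_ge_zero order_trans[OF norm_ge_zero CD(1)])
    also have "\<dots> = C * D * (exp (d / 2 * a\<^sup>2) * exp (d / 2 * a\<^sup>2))" by simp
    also have "\<dots> = C * D * exp (d * a\<^sup>2)" by (simp add: mult_exp_exp)
    finally show ?thesis .
  qed
  then show "\<exists>C. \<forall>a\<ge>0. norm (b a * c a) \<le> C * exp (d * a\<^sup>2)" by blast
qed

text \<open>Complete the square: d * (a - k / (2 d))^2 >= 0.\<close>

lemma exp_linear_le_gaussian:
  fixes k d a :: real
  assumes "d > 0"
  shows "exp (k * a) \<le> exp (k\<^sup>2 / (4 * d)) * exp (d * a\<^sup>2)"
proof -
  have "0 \<le> d * (a - k / (2 * d))\<^sup>2" using assms by simp
  also have "\<dots> = d * a\<^sup>2 - k * a + k\<^sup>2 / (4 * d)"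
    using assms by (simp add: power2_eq_square field_simps)
  finally show ?thesis by (simp add: mult_exp_exp)
qed

lemma subgaussianI:
  assumes "b \<in> borel_measurable borel" "\<And>a. a \<ge> 0 \<Longrightarrow> norm (b a) \<le> C * exp (k * a)"
  shows "subgaussian b"
  unfolding subgaussian_def
proof (intro conjI allI impI assms)
  fix d :: real assume d: "d > 0"
  have "norm (b 0) \<le> C * exp (k * 0)" by (rule assms) simp
  then have C: "C \<ge> 0" using norm_ge_zero[of "b 0"] by (simp del: norm_ge_zero)
  have "norm (b a) \<le> (C * exp (k\<^sup>2 / (4 * d))) * exp (d * a\<^sup>2)" if "a \<ge> 0" for a
    using assms(2)[OF that] mult_left_mono[OF exp_linear_le_gaussian[OF d, of k a] C] by simp
  then show "\<exists>C. \<forall>a\<ge>0. norm (b a) \<le> C * exp (d * a\<^sup>2)" by blast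
qed

text \<open>For subgaussian \<open>b\<close> and \<open>Re p > 0\<close> this is, up to the sign
  (-1)^m, the m-th derivative in \<open>p\<close> of the transform with m = 0. It is introduced as a
  moment integral, and the identification is left to uniqueness of Taylor coefficients.\<close>

definition gauss_transform :: "(real \<Rightarrow> complex) \<Rightarrow> nat \<Rightarrow> complex \<Rightarrow> complex" where
  "gauss_transform b m p = integral {0..} (\<lambda>a. of_real (a ^ (2 * m)) * (exp (- p * of_real (a\<^sup>2)) * b a))"

text \<open>A single term of the exponential series gives a^n / n! <= exp a.\<close>

lemma subgaussian_power: "subgaussian (\<lambda>a. of_real (a ^ n))"
proof (rule subgaussianI)
  show "norm (complex_of_real (a ^ n)) \<le> fact n * exp (1 * a)" if "a \<ge> 0" for a
  proof -
    have "(\<Sum>k\<in>{n}. a ^ k / fact k) \<le> (\<Sum>k. a ^ k / fact k)"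
      using summable_exp_generic[of a] that by (intro sum_le_suminf) (auto simp: field_simps)
    also have "\<dots> = exp a" by (simp add: exp_def field_simps)
    finally show ?thesis using that by (simp add: field_simps norm_power)
  qed
qed measurable

lemma gauss_transform_absolutely_integrable:
  assumes "subgaussian b" "Re p > 0"
  shows "(\<lambda>a. of_real (a ^ (2 * m)) * (exp (- p * of_real (a\<^sup>2)) * b a)) absolutely_integrable_on {0..}"
proof -
  have "subgaussian (\<lambda>a. of_real (a ^ (2 * m)) * b a)"
    by (intro subgaussian_mult subgaussian_power assms)
  from subgaussian_absolutely_integrable[OF this assms(2)]
  have "(\<lambda>a. exp (- p * of_real (a\<^sup>2)) * (of_real (a ^ (2 * m)) * b a)) absolutely_integrable_on {0..}" .
  also have "(\<lambda>a. exp (- p * of_real (a\<^sup>2)) * (of_real (a ^ (2 * m)) * b a))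
      = (\<lambda>a. of_real (a ^ (2 * m)) * (exp (- p * of_real (a\<^sup>2)) * b a))"
    by (rule ext) (rule mult.left_commute)
  finally show ?thesis .
qed

text \<open>Expand exp (- (p - p0) * a^2). The norms of its terms sum to at most exp (|p - p0| *
  a^2), so inside this disc a Gaussian decay of rate Re p0 - |p - p0| > 0 remains for the
  majorant.\<close>

lemma gauss_transform_taylor:
  assumes b: "subgaussian b" and p0: "Re p0 > 0" and p: "norm (p - p0) < Re p0"
  shows "(\<lambda>m. ((-1) ^ m * gauss_transform b m p0 / fact m) * (p - p0) ^ m) sums gauss_transform b 0 p"
proof -
  define q where "q = complex_of_real (Re p0 - norm (p - p0))"
  define g where "g = (\<lambda>m a. ((p0 - p) ^ m / fact m) * (of_real (a ^ (2 * m)) * (exp (- p0 * of_real (a\<^sup>2)) * b a)))"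
  have "(\<lambda>m. integral {0..} (g m)) sums integral {0..} (\<lambda>a. exp (- p * of_real (a\<^sup>2)) * b a)"
  proof (rule integral_sums)
    show "g m integrable_on {0..}" for m
      unfolding g_def
      by (intro integrable_on_mult_right set_lebesgue_integral_eq_integral(1) gauss_transform_absolutely_integrable b p0)
    have "(\<lambda>a. exp (- q * of_real (a\<^sup>2)) * b a) absolutely_integrable_on {0..}"
      using p by (intro subgaussian_absolutely_integrable b) (simp add: q_def)
    then show "(\<lambda>a. norm (exp (- q * of_real (a\<^sup>2)) * b a)) integrable_on {0..}"
      by (simp add: absolutely_integrable_on_def)
  next
    fix n and a :: real
    let ?y = "norm (p - p0) * a\<^sup>2"
    have "(\<Sum>m<n. norm (g m a)) = (\<Sum>m<n. ?y ^ m / fact m) * (exp (- Re p0 * a\<^sup>2) * norm (b a))"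
      unfolding sum_distrib_right
    proof (intro sum.cong refl)
      fix m
      have 1: "norm (complex_of_real (a ^ (2 * m))) = (a\<^sup>2) ^ m" by (simp add: power_mult norm_power)
      have 2: "norm ((p0 - p) ^ m) = norm (p - p0) ^ m" by (simp add: norm_power norm_minus_commute)
      have 3: "norm (exp (- p0 * of_real (a\<^sup>2))) = exp (- Re p0 * a\<^sup>2)"
        unfolding norm_exp_eq_Re by (simp del: of_real_power)
      show "norm (g m a) = ?y ^ m / fact m * (exp (- Re p0 * a\<^sup>2) * norm (b a))"
        unfolding g_def norm_mult norm_divide 1 2 3 power_mult_distrib by simp
    qed
    also have "\<dots> \<le> exp ?y * (exp (- Re p0 * a\<^sup>2) * norm (b a))"
    proof (intro mult_right_mono)
      have "(\<Sum>m<n. ?y ^ m / fact m) \<le> (\<Sum>m. ?y ^ m / fact m)"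
        using summable_exp_generic[of ?y] by (intro sum_le_suminf) (auto simp: field_simps)
      then show "(\<Sum>m<n. ?y ^ m / fact m) \<le> exp ?y" by (simp add: exp_def field_simps)
    qed auto
    also have "\<dots> = norm (exp (- q * of_real (a\<^sup>2)) * b a)"
      unfolding norm_mult norm_exp_eq_Re mult.assoc[symmetric] exp_add[symmetric]
      by (simp add: q_def left_diff_distrib)
    finally show "(\<Sum>m<n. norm (g m a)) \<le> norm (exp (- q * of_real (a\<^sup>2)) * b a)" .
  next
    fix a :: real
    define Y where "Y = complex_of_real (a\<^sup>2)"
    have "(\<lambda>m. ((p0 - p) * Y) ^ m /\<^sub>R fact m * (exp (- p0 * Y) * b a)) sums
       (exp ((p0 - p) * Y) * (exp (- p0 * Y) * b a))"
      by (intro sums_mult2 exp_converges)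
    also have "exp ((p0 - p) * Y) * (exp (- p0 * Y) * b a) = exp (- p * Y) * b a"
      unfolding mult.assoc[symmetric] exp_add[symmetric] by (simp add: algebra_simps)
    also have "(\<lambda>m. ((p0 - p) * Y) ^ m /\<^sub>R fact m * (exp (- p0 * Y) * b a)) = (\<lambda>m. g m a)"
    proof
      fix m
      have "complex_of_real (a ^ (2 * m)) = Y ^ m" by (simp add: Y_def power_mult)
      then show "((p0 - p) * Y) ^ m /\<^sub>R fact m * (exp (- p0 * Y) * b a) = g m a"
        unfolding g_def Y_def[symmetric]
        by (simp add: power_mult_distrib scaleR_conv_of_real divide_inverse mult_ac)
    qed
    finally show "(\<lambda>m. g m a) sums (exp (- p * of_real (a\<^sup>2)) * b a)"
      by (simp only: Y_def)
  qed
  moreover have "integral {0..} (g m) = ((-1) ^ m * gauss_transform b m p0 / fact m) * (p - p0) ^ m" for m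
  proof -
    have "(p0 - p) ^ m = (-1) ^ m * (p - p0) ^ m"
      by (metis minus_diff_eq power_minus)
    then show ?thesis by (simp add: g_def gauss_transform_def integral_mult_right)
  qed
  ultimately show ?thesis by (simp add: gauss_transform_def)
qed

lemma gauss_transform_analytic:
  assumes "subgaussian b" "Re p > 0"
  shows "gauss_transform b 0 analytic_on {p}"
proof -
  have "gauss_transform b 0 analytic_on ball p (Re p)"
    by (rule power_series_analytic, rule gauss_transform_taylor[OF assms]) (simp add: dist_norm norm_minus_commute)
  then show ?thesis by (rule analytic_on_subset) (use assms(2) in auto)
qed

subsection \<open>The transform of the second Bessel factor\<close>

text \<open>For \<open>a > 0\<close> this is \<open>a\<^bsup>2\<nu>+2\<^esup> * J\<^bsub>\<nu>-1/2\<^esub>(a\<^sup>2)\<close> up to the factor \<open>2 powr (\<nu> - 1/2)\<close>.\<close>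

definition bessel_kernel :: "real \<Rightarrow> real \<Rightarrow> real" where
  "bessel_kernel \<nu> a = a powr (4 * \<nu> + 1) * bessel_red (\<nu> - 1/2) ((a\<^sup>2 / 2)\<^sup>2)"

lemma bessel_kernel_conv_bessel_u:
  assumes "a > 0"
  shows "bessel_kernel \<nu> a = a powr (2 * \<nu> + 1) * bessel_u (\<nu> - 1/2) (a\<^sup>2)"
proof -
  have "a\<^sup>2 = a powr 2" using assms by simp
  then have "(a\<^sup>2) powr \<nu> = a powr (2 * \<nu>)" by (simp only: powr_powr)
  then have "a powr (4 * \<nu> + 1) = a powr (2 * \<nu> + 1) * (a\<^sup>2) powr \<nu>"
    by (simp add: powr_add[symmetric])
  then show ?thesis
    by (simp add: bessel_kernel_def bessel_u_def power_divide)
qed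

lemma bessel_red_measurable [measurable]:
  assumes "s \<ge> - 3/4"
  shows "bessel_red s \<in> borel_measurable borel"
proof (rule borel_measurable_continuous_onI)
  show "continuous_on UNIV (bessel_red s)"
    by (rule DERIV_continuous_on[OF DERIV_subset[OF has_field_derivative_bessel_red[OF assms]]]) simp
qed

text \<open>The power series alone would give growth like exp (3 a^2 / 2), which is not subgaussian.
  For a >= 1 the boundedness of \<open>bessel_u\<close> leaves only the power a^(2 \<nu> + 1); the
  series bound is used for a < 1, where 4 \<nu> + 1 >= 0 keeps the power of a bounded.\<close>

lemma bessel_kernel_subgaussian:
  assumes \<nu>: "\<nu> \<ge> - 1/4"
  shows "subgaussian (\<lambda>a. of_real (bessel_kernel \<nu> a))"
proof -
  have mu: "\<nu> - 1/2 \<ge> - 3/4" using \<nu> by simp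
  obtain C where C: "C > 0" "\<And>t. t \<ge> 1 \<Longrightarrow> \<bar>bessel_u (\<nu> - 1/2) t\<bar> \<le> C"
    using bessel_u_bounded[OF mu] by metis
  \<comment> \<open>The power series bound at a = 1, where a^2 / 2 = 1/2.\<close>
  define r where "r = rGamma (\<nu> - 1/2 + 1) * exp (3 * (1/2))"
  have r: "r \<ge> 0" using rGamma_div_fact_le[of "\<nu> - 1/2 + 1" 0] \<nu> by (simp add: r_def)
  show ?thesis
  proof (rule subgaussianI)
    show "(\<lambda>a. complex_of_real (bessel_kernel \<nu> a)) \<in> borel_measurable borel"
      unfolding bessel_kernel_def using bessel_red_measurable[OF mu] by measurable
    fix a :: real assume a: "a \<ge> 0"
    have e1: "exp ((2 * \<nu> + 1) * a) \<ge> 1" using a \<nu> by simp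
    have "\<bar>bessel_kernel \<nu> a\<bar> \<le> (r + C) * exp ((2 * \<nu> + 1) * a)"
    proof (cases "a \<ge> 1")
      case True
      have "\<bar>bessel_kernel \<nu> a\<bar> = a powr (2 * \<nu> + 1) * \<bar>bessel_u (\<nu> - 1/2) (a\<^sup>2)\<bar>"
        using True by (simp add: bessel_kernel_conv_bessel_u abs_mult)
      also have "\<dots> \<le> exp ((2 * \<nu> + 1) * a) * C"
      proof (intro mult_mono)
        have "ln a \<le> a" using True ln_le_minus_one[of a] by simp
        then show "a powr (2 * \<nu> + 1) \<le> exp ((2 * \<nu> + 1) * a)"
          using True \<nu> by (simp add: powr_def mult_left_mono)
        show "\<bar>bessel_u (\<nu> - 1/2) (a\<^sup>2)\<bar> \<le> C" using True by (intro C) simp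
      qed auto
      also have "\<dots> \<le> exp ((2 * \<nu> + 1) * a) * (r + C)" using r by (intro mult_left_mono) auto
      finally show ?thesis by (simp add: mult.commute)
    next
      case False
      have "\<bar>bessel_kernel \<nu> a\<bar> = a powr (4 * \<nu> + 1) * \<bar>bessel_red (\<nu> - 1/2) ((a\<^sup>2 / 2)\<^sup>2)\<bar>"
        by (simp add: bessel_kernel_def abs_mult)
      also have "\<dots> \<le> 1 * r"
      proof (intro mult_mono)
        show "a powr (4 * \<nu> + 1) \<le> 1" using False a \<nu> by (intro powr_le1) auto
        have "\<bar>bessel_red (\<nu> - 1/2) ((a\<^sup>2 / 2)\<^sup>2)\<bar> \<le> rGamma (\<nu> - 1/2 + 1) * exp (3 * (a\<^sup>2 / 2))"
          by (rule bessel_red_bound[OF mu]) simp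
        also have "\<dots> \<le> r" unfolding r_def
        proof (intro mult_left_mono)
          have "a\<^sup>2 \<le> 1" using False a by (simp add: abs_square_le_1)
          then show "exp (3 * (a\<^sup>2 / 2)) \<le> exp (3 * (1/2))" by simp
          show "rGamma (\<nu> - 1/2 + 1) \<ge> 0" using rGamma_div_fact_le[of "\<nu> - 1/2 + 1" 0] \<nu> by simp
        qed
        finally show "\<bar>bessel_red (\<nu> - 1/2) ((a\<^sup>2 / 2)\<^sup>2)\<bar> \<le> r" .
      qed auto
      also have "\<dots> \<le> (r + C) * exp ((2 * \<nu> + 1) * a)"
        using mult_mono[OF _ e1, of r "r + C"] r C(1) by simp
      finally show ?thesis by simp
    qed
    then show "norm (complex_of_real (bessel_kernel \<nu> a)) \<le> (r + C) * exp ((2 * \<nu> + 1) * a)"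
      by simp
  qed
qed

lemma Gamma_duplication_real:
  assumes "z > (0::real)"
  shows "Gamma (2 * z) = 2 powr (2 * z - 1) / sqrt pi * Gamma z * Gamma (z + 1/2)"
proof -
  have "complex_of_real z \<notin> \<int>\<^sub>\<le>\<^sub>0" "complex_of_real z + 1/2 \<notin> \<int>\<^sub>\<le>\<^sub>0"
    using assms by (auto elim!: nonpos_Ints_cases simp: complex_eq_iff)
  from Gamma_legendre_duplication[OF this]
  have "complex_of_real (Gamma z * Gamma (z + 1/2)) = of_real (exp ((1 - 2 * z) * ln 2) * sqrt pi * Gamma (2 * z))"
    by (simp add: Gamma_complex_of_real[symmetric] exp_of_real[symmetric])
  then have "Gamma z * Gamma (z + 1/2) = exp ((1 - 2 * z) * ln 2) * sqrt pi * Gamma (2 * z)"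
    by (simp only: of_real_eq_iff)
  then have "2 powr (2 * z - 1) / sqrt pi * Gamma z * Gamma (z + 1/2)
      = (2 powr (2 * z - 1) * exp ((1 - 2 * z) * ln 2)) * Gamma (2 * z)"
    by (simp add: mult.assoc)
  also have "2 powr (2 * z - 1) * exp ((1 - 2 * z) * ln 2) = (1::real)"
    by (simp add: powr_def mult_exp_exp left_diff_distrib)
  finally show ?thesis by simp
qed

text \<open>The k-th moment contains Gamma (2 z) with z = k + \<nu> + 1/2. Duplication splits it:
  Gamma z cancels against the Bessel coefficient, and Gamma (z + 1/2) = Gamma (\<nu> + 1 + k)
  supplies the binomial coefficients of (1 + 1/p^2)^(- \<nu> - 1).\<close>

lemma bessel_kernel_laplace_real:
  assumes \<nu>: "\<nu> \<ge> - 1/4" and p: "p > (2::real)"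
  shows "gauss_transform (\<lambda>a. of_real (bessel_kernel \<nu> a)) 0 (of_real p)
       = of_real (2 powr (2 * \<nu> - 1) * Gamma (\<nu> + 1) / sqrt pi * (p * (1 + p\<^sup>2) powr (- \<nu> - 1)))"
proof -
  define K where "K = 2 powr (2 * \<nu> - 1) * Gamma (\<nu> + 1) / sqrt pi"
  define d where "d = (\<lambda>k. (-1) ^ k * rGamma (real k + (\<nu> - 1/2) + 1) / fact k / 4 ^ k)"
  define g where "g = (\<lambda>k a. d k * (a powr (2 * (2 * \<nu> + 1 + 2 * real k) - 1) * exp (- p * a\<^sup>2)))"
  have mu: "\<nu> - 1/2 \<ge> - 3/4" and s: "\<nu> - 1/2 + 1 \<ge> 1/4" using \<nu> by simp_all
  have pow: "a powr (2 * (2 * \<nu> + 1 + 2 * real k) - 1) = a powr (4 * \<nu> + 1) * (a\<^sup>2) ^ (2 * k)" if "a \<ge> 0" for a k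
  proof (cases "a = 0")
    case False
    then have a: "a > 0" using that by simp
    have "(a\<^sup>2) ^ (2 * k) = a powr (real (4 * k))"
      using a by (simp only: powr_realpow) (simp add: power_mult[symmetric] mult.assoc[symmetric])
    then show ?thesis by (simp add: powr_add[symmetric] algebra_simps)
  qed auto
  have geq: "g k a = (-1) ^ k * rGamma (real k + (\<nu> - 1/2) + 1) / fact k * ((a\<^sup>2 / 2)\<^sup>2) ^ k
       * (a powr (4 * \<nu> + 1) * exp (- p * a\<^sup>2))" if "a \<ge> 0" for a k
  proof -
    have "((a\<^sup>2 / 2)\<^sup>2) ^ k = (a\<^sup>2) ^ (2 * k) / 4 ^ k"
      by (simp only: power_mult[symmetric] power_divide) (simp add: power_mult)
    then show ?thesis unfolding g_def d_def pow[OF that] by simp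
  qed
  have "(\<lambda>k. integral {0..} (g k)) sums integral {0..} (\<lambda>a. exp (- p * a\<^sup>2) * bessel_kernel \<nu> a)"
  proof (rule integral_sums)
    show "g k integrable_on {0..}" for k
      unfolding g_def
      by (intro integrable_on_mult_right set_lebesgue_integral_eq_integral(1) gaussian_moment(1)) (use \<nu> p in auto)
    \<comment> \<open>The factor exp (3 z) with z = a^2 / 2 costs 3/2 of the decay rate; p > 2 can
      afford it, and smaller p are reached by continuation.\<close>
    show "(\<lambda>a. rGamma (\<nu> - 1/2 + 1) * (a powr (2 * (2 * \<nu> + 1) - 1) * exp (- (p - 3/2) * a\<^sup>2))) integrable_on {0..}"
      by (intro integrable_on_mult_right set_lebesgue_integral_eq_integral(1) gaussian_moment(1)) (use \<nu> p in auto)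
  next
    fix n and a :: real assume "a \<in> {0..}"
    then have a: "a \<ge> 0" by simp
    have "norm (g k a) = rGamma (real k + (\<nu> - 1/2 + 1)) / fact k * ((a\<^sup>2 / 2)\<^sup>2) ^ k * (a powr (4 * \<nu> + 1) * exp (- p * a\<^sup>2))" for k
      unfolding geq[OF a] using rGamma_div_fact_le[OF s, of k] by (simp add: abs_mult power_abs add.assoc)
    then have "(\<Sum>k<n. norm (g k a)) = (\<Sum>k<n. rGamma (real k + (\<nu> - 1/2 + 1)) / fact k * ((a\<^sup>2 / 2)\<^sup>2) ^ k) * (a powr (4 * \<nu> + 1) * exp (- p * a\<^sup>2))"
      by (simp add: sum_distrib_right)
    also have "\<dots> \<le> (rGamma (\<nu> - 1/2 + 1) * exp (3 * (a\<^sup>2 / 2))) * (a powr (4 * \<nu> + 1) * exp (- p * a\<^sup>2))"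
      by (intro mult_right_mono sum_rGamma_le s) auto
    also have "\<dots> = rGamma (\<nu> - 1/2 + 1) * (a powr (4 * \<nu> + 1) * (exp (3 * (a\<^sup>2 / 2)) * exp (- p * a\<^sup>2)))"
      by (simp only: mult_ac)
    also have "exp (3 * (a\<^sup>2 / 2)) * exp (- p * a\<^sup>2) = exp (- (p - 3/2) * a\<^sup>2)"
      unfolding exp_add[symmetric] by (simp add: algebra_simps)
    finally show "(\<Sum>k<n. norm (g k a)) \<le> rGamma (\<nu> - 1/2 + 1) * (a powr (2 * (2 * \<nu> + 1) - 1) * exp (- (p - 3/2) * a\<^sup>2))"
      by (simp add: add.commute)
  next
    fix a :: real assume "a \<in> {0..}"
    then have a: "a \<ge> 0" by simp
    have "(\<lambda>k. g k a) sums (bessel_red (\<nu> - 1/2) ((a\<^sup>2 / 2)\<^sup>2) * (a powr (4 * \<nu> + 1) * exp (- p * a\<^sup>2)))"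
      unfolding geq[OF a] by (intro sums_mult2 bessel_red_sums mu)
    then show "(\<lambda>k. g k a) sums (exp (- p * a\<^sup>2) * bessel_kernel \<nu> a)"
      by (simp add: bessel_kernel_def mult_ac)
  qed
  moreover have "integral {0..} (g k) = K * p powr (- (2 * \<nu> + 1)) * (((- \<nu> - 1) gchoose k) * (1 / p\<^sup>2) ^ k)" for k
  proof -
    define z where "z = real k + \<nu> + 1/2"
    have z: "z > 0" using \<nu> by (simp add: z_def)
    have "integral {0..} (g k) = d k * (Gamma (2 * z) / (2 * p powr (2 * z)))"
    proof -
      have "2 * \<nu> + 1 + 2 * real k = 2 * z" by (simp add: z_def)
      moreover have "integral {0..} (\<lambda>a. a powr (2 * (2 * z) - 1) * exp (- p * a\<^sup>2)) = Gamma (2 * z) / (2 * p powr (2 * z))"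
        using z p by (intro gaussian_moment(2)) auto
      ultimately show ?thesis by (simp only: g_def integral_mult_right)
    qed
    also have "d k = (-1) ^ k / (Gamma z * fact k * 4 ^ k)"
    proof -
      have "real k + (\<nu> - 1/2) + 1 = z" by (simp add: z_def)
      then show ?thesis by (simp only: d_def rGamma_inverse_Gamma) (simp add: field_simps)
    qed
    also have "Gamma (2 * z) = 2 powr (2 * z - 1) / sqrt pi * Gamma z * Gamma (z + 1/2)"
      by (rule Gamma_duplication_real[OF z])
    also have "Gamma (z + 1/2) = Gamma (\<nu> + 1) * pochhammer (\<nu> + 1) k"
    proof -
      have "\<nu> + 1 \<notin> \<int>\<^sub>\<le>\<^sub>0" using \<nu> by (auto elim!: nonpos_Ints_cases)
      then have "pochhammer (\<nu> + 1) k = Gamma (\<nu> + 1 + real k) / Gamma (\<nu> + 1)"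
        and "Gamma (\<nu> + 1) \<noteq> 0"
        by (auto simp: pochhammer_Gamma Gamma_eq_zero_iff)
      then show ?thesis by (simp add: z_def add_ac)
    qed
    also have "2 powr (2 * z - 1) = 2 powr (2 * \<nu>) * 4 ^ k"
    proof -
      have "2 powr (2 * z - 1) = 2 powr (2 * \<nu>) * 2 powr (real (2 * k))"
        unfolding powr_add[symmetric] by (simp add: z_def algebra_simps)
      then show ?thesis by (simp only: powr_realpow zero_less_numeral) (simp add: power_mult)
    qed
    also have "p powr (2 * z) = p powr (2 * \<nu> + 1) * (p\<^sup>2) ^ k"
    proof -
      have "p powr (2 * z) = p powr (2 * \<nu> + 1) * p powr (real (2 * k))"
        unfolding powr_add[symmetric] by (simp add: z_def algebra_simps)
      then show ?thesis using p by (simp only: powr_realpow) (simp add: power_mult powr_realpow)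
    qed
    finally have "integral {0..} (g k) = (-1) ^ k / (Gamma z * fact k * 4 ^ k) *
      (2 powr (2 * \<nu>) * 4 ^ k / sqrt pi * Gamma z * (Gamma (\<nu> + 1) * pochhammer (\<nu> + 1) k) /
        (2 * (p powr (2 * \<nu> + 1) * (p\<^sup>2) ^ k)))" .
    moreover have "Gamma z \<noteq> 0" using Gamma_real_pos[OF z] by simp
    moreover have "2 powr (2 * \<nu>) = 2 * 2 powr (2 * \<nu> - 1)"
      by (simp add: powr_diff)
    ultimately show ?thesis
      using p unfolding powr_minus[of p "2 * \<nu> + 1"]
      by (simp add: K_def gbinomial_pochhammer power_divide field_simps)
  qed
  moreover have "(\<lambda>k. K * p powr (- (2 * \<nu> + 1)) * (((- \<nu> - 1) gchoose k) * (1 / p\<^sup>2) ^ k))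
      sums (K * p powr (- (2 * \<nu> + 1)) * (1 + 1 / p\<^sup>2) powr (- \<nu> - 1))"
  proof (intro sums_mult gen_binomial_real)
    have "1 < p\<^sup>2" using p by (simp add: one_less_power)
    then show "\<bar>1 / p\<^sup>2\<bar> < 1" by (simp add: divide_less_eq)
  qed
  ultimately have "integral {0..} (\<lambda>a. exp (- p * a\<^sup>2) * bessel_kernel \<nu> a)
     = K * p powr (- (2 * \<nu> + 1)) * (1 + 1 / p\<^sup>2) powr (- \<nu> - 1)"
    by (simp only: sums_unique2)
  \<comment> \<open>Taking p^(-2) out of the bracket turns p^(- (2 \<nu> + 1)) into p. In this form
    the apparent singularity at p = 0 has disappeared.\<close>
  also have "\<dots> = K * (p * (1 + p\<^sup>2) powr (- \<nu> - 1))"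
  proof -
    have "1 + 1 / p\<^sup>2 = (1 + p\<^sup>2) * p powr (- 2)" using p by (simp add: field_simps powr_minus)
    then have "(1 + 1 / p\<^sup>2) powr (- \<nu> - 1) = (1 + p\<^sup>2) powr (- \<nu> - 1) * p powr (- 2 * (- \<nu> - 1))"
      using p by (simp only:) (subst powr_mult, auto simp: powr_powr)
    moreover have "p powr (- (2 * \<nu> + 1)) * p powr (- 2 * (- \<nu> - 1)) = p"
      using p unfolding powr_add[symmetric] by simp
    ultimately show ?thesis by (simp add: mult_ac)
  qed
  finally have I: "integral {0..} (\<lambda>a. exp (- p * a\<^sup>2) * bessel_kernel \<nu> a) = K * (p * (1 + p\<^sup>2) powr (- \<nu> - 1))" .
  \<comment> \<open>Integrability is available for the complex integrand; taking real parts gives it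
    for the real one, and then \<open>of_real\<close> commutes with the integral.\<close>
  have "(\<lambda>a. exp (- of_real p * of_real (a\<^sup>2)) * complex_of_real (bessel_kernel \<nu> a)) absolutely_integrable_on {0..}"
    by (rule subgaussian_absolutely_integrable[OF bessel_kernel_subgaussian[OF \<nu>]]) (use p in simp)
  then have "(\<lambda>a. complex_of_real (exp (- p * a\<^sup>2) * bessel_kernel \<nu> a)) integrable_on {0..}"
    using set_lebesgue_integral_eq_integral(1) by (simp add: exp_of_real[symmetric])
  then have "integral {0..} (\<lambda>a. complex_of_real (exp (- p * a\<^sup>2) * bessel_kernel \<nu> a))
      = of_real (integral {0..} (\<lambda>a. exp (- p * a\<^sup>2) * bessel_kernel \<nu> a))"
    using integral_linear[OF _ bounded_linear_of_real[where 'a=complex], of "\<lambda>a. exp (- p * a\<^sup>2) * bessel_kernel \<nu> a" "{0..}"]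
      integrable_linear[OF _ bounded_linear_Re, of "\<lambda>a. complex_of_real (exp (- p * a\<^sup>2) * bessel_kernel \<nu> a)" "{0..}"]
    by (simp add: o_def)
  then show ?thesis
    unfolding I K_def gauss_transform_def by (simp add: exp_of_real[symmetric])
qed

section \<open>Closed form of the transform, its continuation and its derivatives\<close>

definition bessel_laplace :: "real \<Rightarrow> complex \<Rightarrow> complex" where
  "bessel_laplace \<nu> p = of_real (2 powr (2 * \<nu> - 1) * Gamma (\<nu> + 1) / sqrt pi) * (p * (1 + p\<^sup>2) powr of_real (- \<nu> - 1))"

text \<open>If 1 + p^2 <= 0, then p^2 <= -1, so p is purely imaginary with |p| >= 1. Both
  alternatives of the hypothesis exclude this.\<close>

lemma one_plus_square_notin_nonpos_Reals:
  assumes "Re p > 0 \<or> norm p < 1"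
  shows "1 + p\<^sup>2 \<notin> \<real>\<^sub>\<le>\<^sub>0"
proof
  assume "1 + p\<^sup>2 \<in> \<real>\<^sub>\<le>\<^sub>0"
  then obtain r where r: "r \<le> 0" "1 + p\<^sup>2 = of_real r" by (auto elim: nonpos_Reals_cases)
  then have e: "p\<^sup>2 = of_real (r - 1)" by (simp add: algebra_simps)
  have "norm p ^ 2 = \<bar>r - 1\<bar>" unfolding norm_power[symmetric] e norm_of_real ..
  then have "norm p ^ 2 \<ge> 1" using r(1) by simp
  then have "norm p \<ge> 1" by (metis norm_ge_zero one_power2 power2_le_imp_le)
  moreover have "\<not> Re p > 0"
  proof
    assume pos: "Re p > 0"
    have "Im (p\<^sup>2) = 0" "Re (p\<^sup>2) = r - 1" by (simp_all only: e Im_complex_of_real Re_complex_of_real)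
    then have "2 * Re p * Im p = 0" "(Re p)\<^sup>2 - (Im p)\<^sup>2 = r - 1" by (simp_all only: Re_power2 Im_power2)
    with pos have "(Re p)\<^sup>2 = r - 1" by simp
    then show False using r(1) zero_le_power2[of "Re p"] by linarith
  qed
  ultimately show False using assms by simp
qed

text \<open>The half-plane is where the identity with the integral is proved; the disc adds a full
  neighbourhood of p = 0, where the regularisation is removed.\<close>

lemma bessel_laplace_holomorphic:
  "bessel_laplace \<nu> holomorphic_on {p. Re p > 0 \<or> norm p < 1}"
  unfolding bessel_laplace_def[abs_def]
  by (intro holomorphic_intros) (use one_plus_square_notin_nonpos_Reals in auto)

lemma bessel_kernel_laplace:
  assumes \<nu>: "\<nu> \<ge> - 1/4" and p: "Re p > 0"
  shows "gauss_transform (\<lambda>a. of_real (bessel_kernel \<nu> a)) 0 p = bessel_laplace \<nu> p"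
proof -
  let ?G = "gauss_transform (\<lambda>a. of_real (bessel_kernel \<nu> a)) 0"
  have "?G p - bessel_laplace \<nu> p = 0"
  proof (rule analytic_continuation[where f = "\<lambda>p. ?G p - bessel_laplace \<nu> p" and w = p and S = "{p. Re p > 0}" and U = "of_real ` {2<..}" and \<xi> = 3])
    have "?G holomorphic_on {p. Re p > 0}"
      using gauss_transform_analytic[OF bessel_kernel_subgaussian[OF \<nu>]]
      by (intro analytic_imp_holomorphic) (auto simp: analytic_on_def)
    then show "(\<lambda>p. ?G p - bessel_laplace \<nu> p) holomorphic_on {p. Re p > 0}"
      by (intro holomorphic_on_diff holomorphic_on_subset[OF bessel_laplace_holomorphic]) auto
    show "open {p. Re p > 0}" by (rule open_halfspace_Re_gt)
    show "connected {p. Re p > 0}" by (intro convex_connected convex_halfspace_Re_gt)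
    show "(3::complex) islimpt of_real ` {2<..}"
      unfolding islimpt_approachable
    proof (intro allI impI)
      fix e :: real assume "e > 0"
      then show "\<exists>x'\<in>of_real ` {2<..}. x' \<noteq> (3::complex) \<and> dist x' 3 < e"
        by (intro bexI[of _ "of_real (3 + e / 2)"] imageI)
           (auto simp: dist_norm norm_divide complex_eq_iff)
    qed
    fix z :: complex assume "z \<in> of_real ` {2<..}"
    then obtain t where t: "t > 2" "z = of_real t" by auto
    have "1 + (complex_of_real t)\<^sup>2 = of_real (1 + t\<^sup>2)" by simp
    then show "?G z - bessel_laplace \<nu> z = 0"
      unfolding t(2) bessel_kernel_laplace_real[OF \<nu> t(1)] bessel_laplace_def
      by (simp add: powr_of_real[symmetric] add_nonneg_nonneg del: of_real_add of_real_power)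
  qed (use p in auto)
  then show ?thesis by simp
qed

text \<open>The same function has two Taylor series at p, one with its derivatives and one with the
  moment integrals; their coefficients agree.\<close>

lemma gauss_transform_bessel_kernel:
  assumes \<nu>: "\<nu> \<ge> - 1/4" and p: "Re p > 0"
  shows "gauss_transform (\<lambda>a. of_real (bessel_kernel \<nu> a)) m p = (-1) ^ m * (deriv ^^ m) (bessel_laplace \<nu>) p"
proof -
  let ?b = "\<lambda>a. complex_of_real (bessel_kernel \<nu> a)"
  have b: "subgaussian ?b" by (rule bessel_kernel_subgaussian[OF \<nu>])
  have pos: "Re w > 0" if "w \<in> ball p (Re p)" for w
    using that abs_Re_le_cmod[of "p - w"] by (auto simp: dist_norm)
  have "bessel_laplace \<nu> analytic_on ball p (Re p)"
    using pos by (subst analytic_on_open) (auto intro!: holomorphic_on_subset[OF bessel_laplace_holomorphic])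
  then have 1: "(\<lambda>n. (deriv ^^ n) (bessel_laplace \<nu>) p / fact n * (w - p) ^ n) sums bessel_laplace \<nu> w"
    if "w \<in> ball p (Re p)" for w
    using that by (simp only: analytic_iff_power_series)
  have 2: "(\<lambda>n. ((-1) ^ n * gauss_transform ?b n p / fact n) * (w - p) ^ n) sums bessel_laplace \<nu> w"
    if "w \<in> ball p (Re p)" for w
    unfolding bessel_kernel_laplace[OF \<nu> pos[OF that], symmetric]
    by (rule gauss_transform_taylor[OF b p]) (use that in \<open>simp add: dist_norm norm_minus_commute\<close>)
  have "(deriv ^^ m) (bessel_laplace \<nu>) p / fact m = (-1) ^ m * gauss_transform ?b m p / fact m"
    using powser_coeff_unique[OF p 1 2] by (rule fun_cong)
  then have "(deriv ^^ m) (bessel_laplace \<nu>) p = (-1) ^ m * gauss_transform ?b m p" by simp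
  then show ?thesis by (simp add: mult.assoc[symmetric] power_mult_distrib[symmetric])
qed

text \<open>The function is p times a power of 1 + p^2, hence odd. Its odd coefficients are those of
  the binomial series in p^2, shifted by the factor p.\<close>

lemma bessel_laplace_deriv_0:
  shows "(deriv ^^ (2 * k)) (bessel_laplace \<nu>) 0 = 0"
    "(deriv ^^ (2 * k + 1)) (bessel_laplace \<nu>) 0
       = fact (2 * k + 1) * of_real (2 powr (2 * \<nu> - 1) * Gamma (\<nu> + 1) / sqrt pi * ((- \<nu> - 1) gchoose k))"
proof -
  define K where "K = 2 powr (2 * \<nu> - 1) * Gamma (\<nu> + 1) / sqrt pi"
  define c where "c = (\<lambda>n. if odd n then of_real (K * ((- \<nu> - 1) gchoose (n div 2))) else (0::complex))"
  have "bessel_laplace \<nu> analytic_on ball 0 1"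
    by (subst analytic_on_open) (auto intro!: holomorphic_on_subset[OF bessel_laplace_holomorphic])
  then have 1: "(\<lambda>n. (deriv ^^ n) (bessel_laplace \<nu>) 0 / fact n * (w - 0) ^ n) sums bessel_laplace \<nu> w"
    if "w \<in> ball 0 1" for w
    using that by (simp only: analytic_iff_power_series)
  have 2: "(\<lambda>n. c n * (w - 0) ^ n) sums bessel_laplace \<nu> w" if "w \<in> ball 0 1" for w
  proof -
    have "norm (w\<^sup>2) < 1" using that by (simp add: norm_power abs_square_less_1)
    then have "(\<lambda>k. (of_real (- \<nu> - 1) gchoose k) * (w\<^sup>2) ^ k) sums (1 + w\<^sup>2) powr of_real (- \<nu> - 1)"
      by (rule gen_binomial_complex)
    then have "(\<lambda>k. of_real K * w * ((of_real (- \<nu> - 1) gchoose k) * (w\<^sup>2) ^ k)) sums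
        (of_real K * w * (1 + w\<^sup>2) powr of_real (- \<nu> - 1))"
      by (rule sums_mult)
    moreover have "of_real K * w * ((of_real (- \<nu> - 1) gchoose k) * (w\<^sup>2) ^ k) = c (2 * k + 1) * (w - 0) ^ (2 * k + 1)" for k
    proof -
      have "complex_of_real ((- \<nu> - 1) gchoose k) = of_real (- \<nu> - 1) gchoose k"
        by (simp add: gbinomial_prod_rev)
      then show ?thesis by (simp add: c_def power_mult)
    qed
    moreover have "of_real K * w * (1 + w\<^sup>2) powr of_real (- \<nu> - 1) = bessel_laplace \<nu> w"
      by (simp add: bessel_laplace_def K_def)
    ultimately have "(\<lambda>k. c (2 * k + 1) * (w - 0) ^ (2 * k + 1)) sums bessel_laplace \<nu> w" by (simp only:)
    then show ?thesis
      by (subst (asm) sums_mono_reindex[where g = "\<lambda>k. 2 * k + 1" and f = "\<lambda>n. c n * (w - 0) ^ n"])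
         (auto simp: strict_mono_def c_def image_iff elim!: oddE)
  qed
  have *: "(deriv ^^ n) (bessel_laplace \<nu>) 0 = fact n * c n" for n
    using fun_cong[OF powser_coeff_unique[OF zero_less_one 1 2], of n] by (simp add: field_simps)
  show "(deriv ^^ (2 * k)) (bessel_laplace \<nu>) 0 = 0" by (simp add: * c_def)
  show "(deriv ^^ (2 * k + 1)) (bessel_laplace \<nu>) 0
       = fact (2 * k + 1) * of_real (2 powr (2 * \<nu> - 1) * Gamma (\<nu> + 1) / sqrt pi * ((- \<nu> - 1) gchoose k))"
    unfolding * by (simp add: c_def K_def)
qed

text \<open>Circles of radius 1/2 about points with |\<epsilon>| <= 1/4 stay in the disc of radius
  3/4, a compact subset of the unit disc on which the function is bounded. The bound is therefore
  uniform in \<epsilon>.\<close>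

lemma bessel_laplace_deriv_bound:
  obtains B where "B \<ge> 0" "\<And>m \<epsilon>. norm \<epsilon> \<le> 1/4 \<Longrightarrow> norm ((deriv ^^ m) (bessel_laplace \<nu>) \<epsilon>) \<le> fact m * B * 2 ^ m"
proof -
  have hol: "bessel_laplace \<nu> holomorphic_on ball 0 1"
    by (rule holomorphic_on_subset[OF bessel_laplace_holomorphic]) auto
  have "continuous_on (cball 0 (3/4)) (bessel_laplace \<nu>)"
    by (rule continuous_on_subset[OF holomorphic_on_imp_continuous_on[OF hol]]) auto
  then have "bounded (bessel_laplace \<nu> ` cball 0 (3/4))"
    by (intro compact_imp_bounded compact_continuous_image) auto
  then obtain B where B: "B > 0" "\<And>z. z \<in> cball 0 (3/4) \<Longrightarrow> norm (bessel_laplace \<nu> z) \<le> B"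
    by (auto simp: bounded_pos)
  show ?thesis
  proof (rule that[of B])
    fix m and \<epsilon> :: complex assume e: "norm \<epsilon> \<le> 1/4"
    have sub: "z \<in> cball 0 (3/4)" if "norm (\<epsilon> - z) \<le> 1/2" for z
      using norm_triangle_ineq4[of \<epsilon> "\<epsilon> - z"] e that by simp
    have "norm ((deriv ^^ m) (bessel_laplace \<nu>) \<epsilon>) \<le> fact m * B / (1/2) ^ m"
    proof (rule Cauchy_inequality)
      have 1: "cball \<epsilon> (1/2) \<subseteq> ball 0 1"
      proof
        fix z assume "z \<in> cball \<epsilon> (1/2)"
        then show "z \<in> ball 0 1" using sub[of z] by (simp add: dist_norm)
      qed
      show "bessel_laplace \<nu> holomorphic_on ball \<epsilon> (1/2)"
        using 1 ball_subset_cball by (intro holomorphic_on_subset[OF hol]) blast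
      show "continuous_on (cball \<epsilon> (1/2)) (bessel_laplace \<nu>)"
        by (rule continuous_on_subset[OF holomorphic_on_imp_continuous_on[OF hol] 1])
      show "norm (bessel_laplace \<nu> z) \<le> B" if "norm (\<epsilon> - z) = 1/2" for z
        using that by (intro B sub) simp
    qed auto
    then show "norm ((deriv ^^ m) (bessel_laplace \<nu>) \<epsilon>) \<le> fact m * B * 2 ^ m"
      by (simp add: power_divide)
  qed (use B in auto)
qed

text \<open>Cauchy's m! uses up the 1/m! of the Bessel series, so 1 / Gamma (m + s) alone must beat
  y^m. By (m!)^2 <= (2m)! its decay is at least that of 9^m / m!.\<close>

lemma rGamma_power_summable:
  fixes s y :: real
  assumes "s \<ge> 1/4" "y \<ge> 0"
  shows "summable (\<lambda>m. rGamma (real m + s) * y ^ m)"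
proof (rule summable_comparison_test'[where N = 0])
  show "summable (\<lambda>m. rGamma s * ((9 * y) ^ m /\<^sub>R fact m))"
    by (intro summable_mult summable_exp_generic)
  fix m :: nat
  have r: "rGamma s \<ge> 0" using rGamma_div_fact_le[OF assms(1), of 0] by simp
  have "(fact m * fact m :: nat) \<le> fact (2 * m)"
    unfolding mult_2 by (intro dvd_imp_le fact_fact_dvd_fact) simp
  then have "real (fact m * fact m) \<le> real (fact (2 * m))" by (simp only: of_nat_le_iff)
  then have f: "fact m / fact (2 * m) \<le> 1 / (fact m :: real)"
    by (simp add: field_simps)
  have "rGamma (real m + s) \<le> rGamma s * 9 ^ m * (fact m / fact (2 * m))"
    using rGamma_div_fact_le[OF assms(1), of m] by (simp add: field_simps)
  also have "\<dots> \<le> rGamma s * 9 ^ m * (1 / fact m)"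
    using r by (intro mult_left_mono f) auto
  finally have "rGamma (real m + s) * y ^ m \<le> rGamma s * 9 ^ m * (1 / fact m) * y ^ m"
    using assms(2) by (intro mult_right_mono) auto
  moreover have "norm (rGamma (real m + s) * y ^ m) = rGamma (real m + s) * y ^ m"
    using rGamma_div_fact_le[OF assms(1), of m] assms(2) by (simp add: abs_mult)
  ultimately show "norm (rGamma (real m + s) * y ^ m) \<le> rGamma s * ((9 * y) ^ m /\<^sub>R fact m)"
    by (simp add: power_mult_distrib divide_inverse mult_ac)
qed

subsection \<open>The regularised integral\<close>

lemma bessel_J_entire_summable:
  fixes s :: real and z :: complex
  assumes "s \<ge> - 3/4"
  defines "t \<equiv> (\<lambda>m. of_real ((-1) ^ m * rGamma (real m + s + 1) / fact m) * (z / 2) ^ (2 * m))"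
  shows "(\<Sum>m<n. norm (t m)) \<le> rGamma (s + 1) * exp (3 / 2 * norm z)"
    and "t sums bessel_J_entire (of_real s) z"
proof -
  have *: "norm (t m) = rGamma (real m + (s + 1)) / fact m * ((norm z / 2)\<^sup>2) ^ m" for m
    using rGamma_div_fact_le[of "s + 1" m] assms(1)
    by (simp add: t_def norm_mult norm_divide norm_power abs_mult power_mult add.assoc)
  show 1: "(\<Sum>m<n. norm (t m)) \<le> rGamma (s + 1) * exp (3 / 2 * norm z)" for n
    unfolding * using sum_rGamma_le[of "s + 1" "norm z / 2" n] assms(1) by simp
  have "summable (\<lambda>m. norm (t m))"
    by (rule summableI_nonneg_bounded[OF _ 1]) simp
  then have "summable t" by (rule summable_norm_cancel)
  moreover have "t = (\<lambda>m. (-1) ^ m * rGamma (of_nat m + of_real s + 1) / fact m * (z / 2) ^ (2 * m))"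
  proof
    fix m
    have "rGamma (of_nat m + complex_of_real s + 1) = of_real (rGamma (real m + s + 1))"
      unfolding rGamma_complex_of_real[symmetric] by simp
    then show "t m = (-1) ^ m * rGamma (of_nat m + of_real s + 1) / fact m * (z / 2) ^ (2 * m)"
      by (simp add: t_def)
  qed
  ultimately show "t sums bessel_J_entire (of_real s) z"
    unfolding bessel_J_entire_def by (simp only: summable_sums)
qed

lemma bessel_J_entire_norm_le:
  assumes "s \<ge> - 3/4"
  shows "norm (bessel_J_entire (of_real s) z) \<le> rGamma (s + 1) * exp (3 / 2 * norm z)"
proof -
  let ?t = "\<lambda>m. of_real ((-1) ^ m * rGamma (real m + s + 1) / fact m) * (z / 2) ^ (2 * m)"
  have "(\<lambda>n. \<Sum>m<n. ?t m) \<longlonglongrightarrow> bessel_J_entire (of_real s) z"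
    using bessel_J_entire_summable(2)[OF assms] by (simp only: sums_def)
  then have "(\<lambda>n. norm (\<Sum>m<n. ?t m)) \<longlonglongrightarrow> norm (bessel_J_entire (of_real s) z)"
    by (rule tendsto_norm)
  then show ?thesis
    by (rule LIMSEQ_le_const2)
       (use order_trans[OF norm_sum bessel_J_entire_summable(1)[OF assms]] in blast)
qed

lemma bessel_J_entire_of_real:
  assumes "s \<ge> - 3/4"
  shows "bessel_J_entire (of_real s) (of_real t) = of_real (bessel_red s ((t / 2)\<^sup>2))"
proof -
  have "(\<lambda>m. of_real ((-1) ^ m * rGamma (real m + s + 1) / fact m * ((t / 2)\<^sup>2) ^ m))
     sums complex_of_real (bessel_red s ((t / 2)\<^sup>2))"
    by (intro sums_of_real bessel_red_sums assms)
  then have "(\<lambda>m. of_real ((-1) ^ m * rGamma (real m + s + 1) / fact m) * (complex_of_real t / 2) ^ (2 * m))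
     sums complex_of_real (bessel_red s ((t / 2)\<^sup>2))"
    by (simp add: power_mult)
  with bessel_J_entire_summable(2)[OF assms] show ?thesis by (rule sums_unique2)
qed

lemma bessel_J_entire_subgaussian:
  assumes "s \<ge> - 3/4"
  shows "subgaussian (\<lambda>a. bessel_J_entire (of_real s) (of_real a * x))"
proof (rule subgaussianI)
  let ?t = "\<lambda>a m. of_real ((-1) ^ m * rGamma (real m + s + 1) / fact m) * ((of_real a * x) / 2) ^ (2 * m)"
  show "(\<lambda>a. bessel_J_entire (of_real s) (of_real a * x)) \<in> borel_measurable borel"
  proof (rule borel_measurable_LIMSEQ_metric)
    show "(\<lambda>n. \<Sum>m<n. ?t a m) \<longlonglongrightarrow> bessel_J_entire (of_real s) (of_real a * x)" for a
      using bessel_J_entire_summable(2)[OF assms] by (simp only: sums_def)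
    show "(\<lambda>a. \<Sum>m<n. ?t a m) \<in> borel_measurable borel" for n
      by measurable
  qed
  fix a :: real assume "a \<ge> 0"
  then show "norm (bessel_J_entire (of_real s) (of_real a * x)) \<le> rGamma (s + 1) * exp (3 / 2 * norm x * a)"
    using bessel_J_entire_norm_le[OF assms, of "of_real a * x"] by (simp add: norm_mult mult_ac)
qed

lemma bessel_product_subgaussian:
  assumes "\<nu> \<ge> - 1/4"
  shows "subgaussian (\<lambda>a. of_real (bessel_kernel \<nu> a) * bessel_J_entire (of_real (2 * \<nu>)) (of_real a * x))"
  by (intro subgaussian_mult bessel_kernel_subgaussian bessel_J_entire_subgaussian) (use assms in auto)

text \<open>The sign (-1)^m of the Bessel series cancels the one that relates the m-th moment to the
  m-th derivative.\<close>

lemma bessel_product_laplace_sums: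
  fixes \<nu> \<epsilon> :: real and x :: complex
  assumes \<nu>: "\<nu> \<ge> - 1/4" and e: "\<epsilon> > 0"
  shows "(\<lambda>m. of_real (rGamma (real m + 2 * \<nu> + 1) / fact m) * (x / 2) ^ (2 * m) * (deriv ^^ m) (bessel_laplace \<nu>) (of_real \<epsilon>))
    sums integral {0..} (\<lambda>a. exp (- of_real \<epsilon> * of_real (a\<^sup>2)) *
      (of_real (bessel_kernel \<nu> a) * bessel_J_entire (of_real (2 * \<nu>)) (of_real a * x)))"
proof -
  let ?b = "\<lambda>a. complex_of_real (bessel_kernel \<nu> a)"
  have s: "2 * \<nu> \<ge> - 3/4" using \<nu> by simp
  have b: "subgaussian ?b" by (rule bessel_kernel_subgaussian[OF \<nu>])
  define c where "c = (\<lambda>m. of_real ((-1) ^ m * rGamma (real m + 2 * \<nu> + 1) / fact m) * (x / 2) ^ (2 * m))"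
  define w where "w = (\<lambda>a. exp (- complex_of_real \<epsilon> * of_real (a\<^sup>2)) * ?b a)"
  have cm: "of_real ((-1) ^ m * rGamma (real m + 2 * \<nu> + 1) / fact m) * ((of_real a * x) / 2) ^ (2 * m)
      = c m * of_real (a ^ (2 * m))" for a m
    by (simp add: c_def power_mult_distrib power_divide)
  have "(\<lambda>m. integral {0..} (\<lambda>a. c m * (of_real (a ^ (2 * m)) * w a)))
      sums integral {0..} (\<lambda>a. w a * bessel_J_entire (of_real (2 * \<nu>)) (of_real a * x))"
  proof (rule integral_sums)
    show "(\<lambda>a. c m * (of_real (a ^ (2 * m)) * w a)) integrable_on {0..}" for m
      unfolding w_def
      by (intro integrable_on_mult_right set_lebesgue_integral_eq_integral(1) gauss_transform_absolutely_integrable b) (simp add: e)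
    \<comment> \<open>For the majorant the first Bessel factor is replaced by its exponential bound,
      which is still subgaussian.\<close>
    have "subgaussian (\<lambda>a. of_real (rGamma (2 * \<nu> + 1) * exp (3 / 2 * norm x * a)))"
    proof (rule subgaussianI)
      have "rGamma (2 * \<nu> + 1) \<ge> 0" using rGamma_div_fact_le[of "2 * \<nu> + 1" 0] \<nu> by simp
      then show "norm (complex_of_real (rGamma (2 * \<nu> + 1) * exp (3 / 2 * norm x * a)))
          \<le> rGamma (2 * \<nu> + 1) * exp (3 / 2 * norm x * a)" for a
        unfolding norm_of_real by simp
    qed measurable
    from subgaussian_absolutely_integrable[OF subgaussian_mult[OF this b], of "of_real \<epsilon>"]
    show "(\<lambda>a. norm (exp (- complex_of_real \<epsilon> * of_real (a\<^sup>2)) * (of_real (rGamma (2 * \<nu> + 1) * exp (3 / 2 * norm x * a)) * ?b a))) integrable_on {0..}"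
      using e unfolding absolutely_integrable_on_def by simp
  next
    fix n and a :: real assume "a \<in> {0..}"
    then have a: "norm (of_real a * x) = norm x * a" by (simp add: norm_mult)
    have "(\<Sum>m<n. norm (c m * (of_real (a ^ (2 * m)) * w a))) = (\<Sum>m<n. norm (c m * of_real (a ^ (2 * m)))) * norm (w a)"
      unfolding sum_distrib_right by (simp only: norm_mult mult.assoc)
    also have "\<dots> \<le> (rGamma (2 * \<nu> + 1) * exp (3 / 2 * norm (of_real a * x))) * norm (w a)"
      unfolding cm[symmetric] by (intro mult_right_mono bessel_J_entire_summable(1) s) auto
    also have "\<dots> \<le> norm (exp (- complex_of_real \<epsilon> * of_real (a\<^sup>2)) * (of_real (rGamma (2 * \<nu> + 1) * exp (3 / 2 * norm x * a)) * ?b a))"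
    proof -
      have "y * norm (u * v) \<le> norm (u * (of_real y * v))" for y and u v :: complex
        by (simp add: norm_mult mult.left_commute[of _ "\<bar>y\<bar>"] mult_right_mono)
      moreover have "3 / 2 * (norm x * a) = 3 / 2 * norm x * a" by simp
      ultimately show ?thesis unfolding w_def a by (simp only:)
    qed
    finally show "(\<Sum>m<n. norm (c m * (of_real (a ^ (2 * m)) * w a))) \<le> \<dots>" .
  next
    fix a :: real
    have "(\<lambda>m. c m * of_real (a ^ (2 * m)) * w a) sums (bessel_J_entire (of_real (2 * \<nu>)) (of_real a * x) * w a)"
      unfolding cm[symmetric] by (intro sums_mult2 bessel_J_entire_summable(2) s)
    then show "(\<lambda>m. c m * (of_real (a ^ (2 * m)) * w a)) sums (w a * bessel_J_entire (of_real (2 * \<nu>)) (of_real a * x))"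
      by (simp only: mult.assoc mult.commute[of "w a"])
  qed
  moreover have "integral {0..} (\<lambda>a. c m * (of_real (a ^ (2 * m)) * w a))
     = of_real (rGamma (real m + 2 * \<nu> + 1) / fact m) * (x / 2) ^ (2 * m) * (deriv ^^ m) (bessel_laplace \<nu>) (of_real \<epsilon>)" for m
  proof -
    have "integral {0..} (\<lambda>a. c m * (of_real (a ^ (2 * m)) * w a)) = c m * gauss_transform ?b m (of_real \<epsilon>)"
      unfolding gauss_transform_def w_def integral_mult_right ..
    also have "\<dots> = c m * ((-1) ^ m * (deriv ^^ m) (bessel_laplace \<nu>) (of_real \<epsilon>))"
      by (subst gauss_transform_bessel_kernel[OF \<nu>]) (use e in auto)
    also have "c m * (-1) ^ m = of_real (rGamma (real m + 2 * \<nu> + 1) / fact m) * (x / 2) ^ (2 * m) * ((-1) ^ m * (-1) ^ m)"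
      by (simp add: c_def)
    then have "c m * ((-1) ^ m * (deriv ^^ m) (bessel_laplace \<nu>) (of_real \<epsilon>))
       = of_real (rGamma (real m + 2 * \<nu> + 1) / fact m) * (x / 2) ^ (2 * m) * (deriv ^^ m) (bessel_laplace \<nu>) (of_real \<epsilon>)"
      unfolding mult.assoc[symmetric] by (simp add: power_mult_distrib[symmetric])
    finally show ?thesis .
  qed
  ultimately show ?thesis by (simp only: w_def mult.assoc)
qed

lemma bessel_product_abel_limit:
  fixes \<nu> :: real and x :: complex
  assumes \<nu>: "\<nu> \<ge> - 1/4"
  shows "((\<lambda>\<epsilon>. integral {0..} (\<lambda>a. exp (- of_real \<epsilon> * of_real (a\<^sup>2)) *
      (of_real (bessel_kernel \<nu> a) * bessel_J_entire (of_real (2 * \<nu>)) (of_real a * x))))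
    \<longlongrightarrow> (\<Sum>m. of_real (rGamma (real m + 2 * \<nu> + 1) / fact m) * (x / 2) ^ (2 * m) * (deriv ^^ m) (bessel_laplace \<nu>) 0))
    (at_right 0)"
proof -
  define c where "c = (\<lambda>m. of_real (rGamma (real m + 2 * \<nu> + 1) / fact m) * (x / 2) ^ (2 * m))"
  obtain B where B: "B \<ge> 0" "\<And>m \<epsilon>. norm \<epsilon> \<le> 1/4 \<Longrightarrow> norm ((deriv ^^ m) (bessel_laplace \<nu>) \<epsilon>) \<le> fact m * B * 2 ^ m"
    using bessel_laplace_deriv_bound by metis
  \<comment> \<open>The factorials cancel, and |x|^2 / 4 from the series times 2 from Cauchy's
    estimate gives |x|^2 / 2.\<close>
  define M where "M = (\<lambda>m. B * (rGamma (real m + (2 * \<nu> + 1)) * ((norm x)\<^sup>2 / 2) ^ m))"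
  have small: "eventually (\<lambda>\<epsilon>::real. 0 < \<epsilon> \<and> \<epsilon> < 1/4) (at_right 0)"
    using eventually_at_right_real[of 0 "1/4"] by (auto elim: eventually_mono)
  have "((\<lambda>\<epsilon>::real. \<Sum>m. c m * (deriv ^^ m) (bessel_laplace \<nu>) (of_real \<epsilon>))
      \<longlongrightarrow> (\<Sum>m. c m * (deriv ^^ m) (bessel_laplace \<nu>) 0)) (at_right 0)"
  proof (rule tannerys_theorem[THEN conjunct2, THEN conjunct2])
    show "((\<lambda>\<epsilon>. c m * (deriv ^^ m) (bessel_laplace \<nu>) (of_real \<epsilon>)) \<longlongrightarrow> c m * (deriv ^^ m) (bessel_laplace \<nu>) 0) (at_right 0)" for m
    proof (intro tendsto_mult_left)
      have "(deriv ^^ m) (bessel_laplace \<nu>) holomorphic_on ball 0 1"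
        by (intro holomorphic_higher_deriv holomorphic_on_subset[OF bessel_laplace_holomorphic]) auto
      then have "isCont ((deriv ^^ m) (bessel_laplace \<nu>)) 0"
        by (intro continuous_on_interior[OF holomorphic_on_imp_continuous_on]) auto
      moreover have "((\<lambda>\<epsilon>. complex_of_real \<epsilon>) \<longlongrightarrow> of_real 0) (at_right 0)"
        by (intro tendsto_of_real tendsto_ident_at)
      ultimately show "((\<lambda>\<epsilon>. (deriv ^^ m) (bessel_laplace \<nu>) (of_real \<epsilon>)) \<longlongrightarrow> (deriv ^^ m) (bessel_laplace \<nu>) 0) (at_right 0)"
        using isCont_tendsto_compose[of 0 "(deriv ^^ m) (bessel_laplace \<nu>)"] by simp
    qed
    have "norm (c m * (deriv ^^ m) (bessel_laplace \<nu>) (of_real \<epsilon>)) \<le> M m" if "0 < \<epsilon> \<and> \<epsilon> < 1/4" for m and \<epsilon> :: real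
    proof -
      have r: "0 \<le> rGamma (real m + 2 * \<nu> + 1)" using rGamma_div_fact_le[of "2 * \<nu> + 1" m] \<nu> by (simp add: add.assoc)
      have "norm (c m * (deriv ^^ m) (bessel_laplace \<nu>) (of_real \<epsilon>)) \<le> norm (c m) * (fact m * B * 2 ^ m)"
        unfolding norm_mult using that by (intro mult_left_mono B) auto
      also have "norm (c m) = rGamma (real m + 2 * \<nu> + 1) / fact m * ((norm x)\<^sup>2 / 4) ^ m"
        using r by (simp add: c_def norm_mult norm_divide norm_power power_mult power_divide)
      also have "\<dots> * (fact m * B * 2 ^ m) = M m"
        by (simp add: M_def add.assoc power_mult_distrib[symmetric] mult.assoc[symmetric])
      finally show ?thesis .
    qed
    then have "eventually (\<lambda>\<epsilon>. \<forall>m. norm (c m * (deriv ^^ m) (bessel_laplace \<nu>) (of_real \<epsilon>)) \<le> M m) (at_right 0)"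
      using small by (auto elim: eventually_mono)
    \<comment> \<open>The bound holds for every m as soon as \<epsilon> < 1/4, so the condition on m
      in the product filter is taken to be \<open>True\<close>.\<close>
    then show "eventually (\<lambda>(m, \<epsilon>). norm (c m * (deriv ^^ m) (bessel_laplace \<nu>) (of_real \<epsilon>)) \<le> M m) (at_top \<times>\<^sub>F at_right 0)"
      unfolding eventually_prod_filter
      by (intro exI[of _ "\<lambda>_. True"] exI[of _ "\<lambda>\<epsilon>. \<forall>m. norm (c m * (deriv ^^ m) (bessel_laplace \<nu>) (of_real \<epsilon>)) \<le> M m"]) auto
    show "summable M" unfolding M_def
      using \<nu> by (intro summable_mult rGamma_power_summable) auto
  qed auto
  then show ?thesis
    unfolding c_def
  proof (rule Lim_transform_eventually)
    from small show "eventually (\<lambda>\<epsilon>. (\<Sum>m. of_real (rGamma (real m + 2 * \<nu> + 1) / fact m) * (x / 2) ^ (2 * m) * (deriv ^^ m) (bessel_laplace \<nu>) (of_real \<epsilon>))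
        = integral {0..} (\<lambda>a. exp (- of_real \<epsilon> * of_real (a\<^sup>2)) *
      (of_real (bessel_kernel \<nu> a) * bessel_J_entire (of_real (2 * \<nu>)) (of_real a * x)))) (at_right 0)"
      by eventually_elim (rule sums_unique[symmetric, OF bessel_product_laplace_sums[OF \<nu>]], simp)
  qed
qed

text \<open>Only m = 2 k + 1 contributes. With z = k + \<nu> + 1 the coefficient contains 1 / Gamma
  (2 z); in its duplication Gamma z cancels against the Pochhammer symbol of the binomial
  coefficient, and 1 / Gamma (z + 1/2) is the Bessel coefficient of order \<nu> + 1/2.\<close>

lemma bessel_product_abel_value:
  fixes \<nu> :: real and x :: complex
  assumes \<nu>: "\<nu> \<ge> - 1/4"
  shows "(\<Sum>m. of_real (rGamma (real m + 2 * \<nu> + 1) / fact m) * (x / 2) ^ (2 * m) * (deriv ^^ m) (bessel_laplace \<nu>) 0)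
     = x\<^sup>2 / 16 * bessel_J_entire (of_real (\<nu> + 1/2)) (x\<^sup>2 / 4)"
proof -
  define t where "t = (\<lambda>m. of_real (rGamma (real m + 2 * \<nu> + 1) / fact m) * (x / 2) ^ (2 * m) * (deriv ^^ m) (bessel_laplace \<nu>) 0)"
  have "(\<lambda>k. x\<^sup>2 / 16 * (of_real ((-1) ^ k * rGamma (real k + (\<nu> + 1/2) + 1) / fact k) * ((x\<^sup>2 / 4) / 2) ^ (2 * k)))
     sums (x\<^sup>2 / 16 * bessel_J_entire (of_real (\<nu> + 1/2)) (x\<^sup>2 / 4))"
    by (intro sums_mult bessel_J_entire_summable(2)) (use \<nu> in auto)
  moreover have "x\<^sup>2 / 16 * (of_real ((-1) ^ k * rGamma (real k + (\<nu> + 1/2) + 1) / fact k) * ((x\<^sup>2 / 4) / 2) ^ (2 * k))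
      = t (2 * k + 1)" for k
  proof -
    define z where "z = real k + \<nu> + 1"
    have z: "z > 0" using \<nu> by (simp add: z_def)
    have G: "Gamma z > 0" "Gamma (z + 1/2) > 0" "Gamma (\<nu> + 1) > 0"
      using \<nu> by (auto intro!: Gamma_real_pos simp: z_def)
    have "\<nu> + 1 \<notin> \<int>\<^sub>\<le>\<^sub>0" using \<nu> by (auto elim!: nonpos_Ints_cases)
    then have P: "pochhammer (\<nu> + 1) k = Gamma z / Gamma (\<nu> + 1)"
      by (simp add: pochhammer_Gamma z_def add_ac)
    have pw: "2 powr (2 * z - 1) = 4 * 2 powr (2 * \<nu> - 1) * 4 ^ k"
    proof -
      have "2 powr (2 * z - 1) = 2 powr (2 * \<nu> - 1) * 2 powr (real (2 * (k + 1)))"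
        unfolding powr_add[symmetric] by (simp add: z_def algebra_simps)
      then show ?thesis by (simp only: powr_realpow zero_less_numeral) (simp add: power_mult)
    qed
    have z1: "real (2 * k + 1) + 2 * \<nu> + 1 = 2 * z" and z2: "real k + (\<nu> + 1/2) + 1 = z + 1/2"
      by (simp_all add: z_def)
    have "rGamma (2 * z) * (2 powr (2 * \<nu> - 1) * Gamma (\<nu> + 1) / sqrt pi * ((- \<nu> - 1) gchoose k))
      = (-1) ^ k * rGamma (z + 1/2) / fact k / (4 * 4 ^ k)"
      unfolding rGamma_inverse_Gamma Gamma_duplication_real[OF z] pw gbinomial_pochhammer
      using G P by (simp add: field_simps)
    then have "complex_of_real (rGamma (2 * z) * (2 powr (2 * \<nu> - 1) * Gamma (\<nu> + 1) / sqrt pi * ((- \<nu> - 1) gchoose k)))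
      = of_real ((-1) ^ k * rGamma (z + 1/2) / fact k / (4 * 4 ^ k))"
      by (simp only:)
    moreover have "t (2 * k + 1) = (x / 2) ^ (2 * (2 * k + 1)) *
       complex_of_real (rGamma (2 * z) * (2 powr (2 * \<nu> - 1) * Gamma (\<nu> + 1) / sqrt pi * ((- \<nu> - 1) gchoose k)))"
      unfolding t_def bessel_laplace_deriv_0(2) z1 by (simp del: fact_Suc)
    ultimately have "t (2 * k + 1) = (x / 2) ^ (2 * (2 * k + 1)) * of_real ((-1) ^ k * rGamma (z + 1/2) / fact k / (4 * 4 ^ k))"
      by (simp only:)
    also have "(x / 2) ^ (2 * (2 * k + 1)) = x\<^sup>2 / 4 * ((x\<^sup>2 / 4) / 2) ^ (2 * k) * 4 ^ k"
    proof -
      have "((x\<^sup>2 / 4) / 2) ^ (2 * k) * 4 ^ k = ((x\<^sup>2 / 8)\<^sup>2 * 4) ^ k"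
        by (simp add: power_mult power_mult_distrib)
      also have "(x\<^sup>2 / 8)\<^sup>2 * 4 = (x / 2) ^ 4" by (simp add: power2_eq_square power4_eq_xxxx)
      finally have "((x\<^sup>2 / 4) / 2) ^ (2 * k) * 4 ^ k = (x / 2) ^ (4 * k)" by (simp only: power_mult)
      moreover have "(x / 2) ^ (2 * (2 * k + 1)) = (x / 2)\<^sup>2 * (x / 2) ^ (4 * k)"
        unfolding power_add[symmetric] by simp
      moreover have "(x / 2)\<^sup>2 = x\<^sup>2 / 4" by (simp add: power_divide)
      ultimately show ?thesis by (simp only: mult.assoc)
    qed
    finally show ?thesis unfolding z2 by simp
  qed
  ultimately have "(\<lambda>k. t (2 * k + 1)) sums (x\<^sup>2 / 16 * bessel_J_entire (of_real (\<nu> + 1/2)) (x\<^sup>2 / 4))"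
    by (simp only:)
  then have "t sums (x\<^sup>2 / 16 * bessel_J_entire (of_real (\<nu> + 1/2)) (x\<^sup>2 / 4))"
  proof (subst (asm) sums_mono_reindex[where g = "\<lambda>k. 2 * k + 1" and f = t])
    fix n :: nat assume "n \<notin> range (\<lambda>k. 2 * k + 1)"
    then have "even n" by (metis oddE rangeI)
    then show "t n = 0" by (auto simp: t_def bessel_laplace_deriv_0(1) elim!: evenE)
  qed (auto simp: strict_mono_def)
  then show ?thesis unfolding t_def by (rule sums_unique[symmetric])
qed

subsection \<open>The improper integral\<close>

text \<open>\<open>has_integral\<close> is the gauge integral, which on a half-line includes
  conditionally convergent improper integrals. The function \<open>f\<close> may therefore fail to
  be absolutely integrable.\<close>

lemma has_integral_FTC_to_inf:
  fixes F f :: "real \<Rightarrow> real"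
  assumes deriv: "\<And>a. a \<ge> A \<Longrightarrow> (F has_real_derivative f a) (at a)"
    and lim: "(F \<longlongrightarrow> 0) at_top"
  shows "(f has_integral - F A) {A..}"
proof -
  have FTC: "(f has_integral (F d - F c)) {c..d}" if "A \<le> c" "c \<le> d" for c d
    using that deriv
    by (intro fundamental_theorem_of_calculus)
       (auto simp: has_real_derivative_iff_has_vector_derivative[symmetric] intro: has_field_derivative_at_within)
  have inter: "{A..} \<inter> {c..d} = {max A c..d}" for c d :: real by auto
  show ?thesis
    unfolding has_integral_alt'[of f "- F A" "{A..}"]
  proof (intro conjI allI impI)
    fix c d :: real
    have "f integrable_on {max A c..d}"
      using FTC[of "max A c" d] by (cases "max A c \<le> d") (auto simp: integrable_on_def)
    then show "(\<lambda>x. if x \<in> {A..} then f x else 0) integrable_on cbox c d"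
      unfolding integrable_restrict_Int inter[symmetric] by simp
  next
    fix e :: real assume "e > 0"
    then have "eventually (\<lambda>x. norm (F x) < e) at_top"
      using lim by (simp add: tendsto_iff)
    then obtain N where N: "\<And>x. x \<ge> N \<Longrightarrow> norm (F x) < e"
      by (auto simp: eventually_at_top_linorder)
    show "\<exists>B>0. \<forall>c d. ball 0 B \<subseteq> cbox c d \<longrightarrow>
         norm (integral (cbox c d) (\<lambda>x. if x \<in> {A..} then f x else 0) - - F A) < e"
    \<comment> \<open>An interval containing this ball contains both \<open>A\<close> and
      \<open>N\<close>, so it starts at or before \<open>A\<close> and ends where \<open>F\<close>
      is already small.\<close>
    proof (intro exI[of _ "\<bar>A\<bar> + \<bar>N\<bar> + 1"] conjI allI impI)
      fix c d :: real assume sub: "ball 0 (\<bar>A\<bar> + \<bar>N\<bar> + 1) \<subseteq> cbox c d"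
      have "A \<in> ball 0 (\<bar>A\<bar> + \<bar>N\<bar> + 1)" "N \<in> ball 0 (\<bar>A\<bar> + \<bar>N\<bar> + 1)" by (auto simp: dist_norm)
      with sub have "A \<in> cbox c d" "N \<in> cbox c d" by blast+
      then have le: "c \<le> A" "A \<le> d" "N \<le> d" by auto
      have "integral (cbox c d) (\<lambda>x. if x \<in> {A..} then f x else 0) = integral {A..d} f"
        using le unfolding integral_restrict_Int by (simp add: inter max_def)
      also have "\<dots> = F d - F A" using FTC[of A d] le by (simp add: integral_unique)
      finally show "norm (integral (cbox c d) (\<lambda>x. if x \<in> {A..} then f x else 0) - - F A) < e"
        using N[OF le(3)] by simp
    qed simp
  qed
qed

lemma dominated_convergence_at_right:
  fixes f :: "real \<Rightarrow> 'n::euclidean_space \<Rightarrow> 'm::euclidean_space"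
  assumes f: "\<And>\<epsilon>. \<epsilon> > 0 \<Longrightarrow> f \<epsilon> integrable_on S" and h: "h integrable_on S"
    and le: "\<And>\<epsilon> x. \<epsilon> > 0 \<Longrightarrow> x \<in> S \<Longrightarrow> norm (f \<epsilon> x) \<le> h x"
    and conv: "\<And>x. x \<in> S \<Longrightarrow> ((\<lambda>\<epsilon>. f \<epsilon> x) \<longlongrightarrow> g x) (at_right 0)"
  shows "((\<lambda>\<epsilon>. integral S (f \<epsilon>)) \<longlongrightarrow> integral S g) (at_right 0)"
  unfolding tendsto_at_iff_sequentially
proof (intro allI impI)
  fix X :: "nat \<Rightarrow> real" assume X: "\<forall>i. X i \<in> {0<..} - {0}" "X \<longlonglongrightarrow> 0"
  have "(\<lambda>k. integral S (f (X k))) \<longlonglongrightarrow> integral S g"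
  proof (rule dominated_convergence(2)[OF _ h])
    show "(\<lambda>k. f (X k) x) \<longlonglongrightarrow> g x" if "x \<in> S" for x
      using conv[OF that] X unfolding tendsto_at_iff_sequentially by (auto simp: o_def)
  qed (use X f le in auto)
  then show "((\<lambda>\<epsilon>. integral S (f \<epsilon>)) \<circ> X) \<longlonglongrightarrow> integral S g" by (simp add: o_def)
qed

lemma gaussian_factor_tendsto: "((\<lambda>\<epsilon>. exp (- \<epsilon> * a\<^sup>2) * c) \<longlongrightarrow> (c::real)) (at_right 0)"
proof -
  have "((\<lambda>\<epsilon>. exp (- \<epsilon> * a\<^sup>2) * c) \<longlongrightarrow> exp (- 0 * a\<^sup>2) * c) (at_right 0)"
    by (intro tendsto_intros)
  then show ?thesis by simp
qed

text \<open>Both the improper integral of \<open>g = H' - R\<close> and its Gaussian regularisation are reduced, by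
  integrating \<open>exp (- \<epsilon> * a\<^sup>2) * H\<close> by parts, to absolutely convergent integrals.
  Since \<open>\<epsilon> * a\<^sup>2 * exp (- \<epsilon> * a\<^sup>2) \<le> 1\<close>, these are dominated uniformly in \<open>\<epsilon>\<close>.\<close>

lemma has_integral_improper_gaussian_abel:
  fixes g H R :: "real \<Rightarrow> real"
  assumes A: "A \<ge> 1"
    and deriv: "\<And>a. a \<ge> A \<Longrightarrow> (H has_real_derivative g a + R a) (at a)"
    and H: "\<And>a. a \<ge> A \<Longrightarrow> \<bar>H a\<bar> \<le> C * a powr (- 1/2)"
    and R: "\<And>a. a \<ge> A \<Longrightarrow> \<bar>R a\<bar> \<le> C * a powr (- 3/2)"
    and cont: "continuous_on {A..} R"
  obtains L where "(g has_integral L) {A..}"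
    "\<And>\<epsilon>. \<epsilon> > 0 \<Longrightarrow> (\<lambda>a. exp (- \<epsilon> * a\<^sup>2) * g a) integrable_on {A..}"
    "((\<lambda>\<epsilon>. integral {A..} (\<lambda>a. exp (- \<epsilon> * a\<^sup>2) * g a)) \<longlongrightarrow> L) (at_right 0)"
proof -
  \<comment> \<open>What differs from exp (- \<epsilon> * a^2) * g, up to sign, in the derivative of
    exp (- \<epsilon> * a^2) * H.\<close>
  define Q where "Q = (\<lambda>\<epsilon> a. 2 * \<epsilon> * a * exp (- \<epsilon> * a\<^sup>2) * H a - exp (- \<epsilon> * a\<^sup>2) * R a)"
  have C: "C \<ge> 0"
  proof (rule ccontr)
    assume "\<not> C \<ge> 0"
    then have "C * A powr (- 1/2) < 0" using A by (simp add: mult_neg_pos)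
    then show False using H[of A] by simp
  qed
  have contH: "continuous_on {A..} H"
    using deriv by (intro DERIV_continuous_on[of _ _ "\<lambda>a. g a + R a"]) (auto intro: has_field_derivative_at_within)
  have W: "((\<lambda>a. exp (- \<epsilon> * a\<^sup>2) * H a) has_real_derivative exp (- \<epsilon> * a\<^sup>2) * g a - Q \<epsilon> a) (at a)" if "a \<ge> A" for \<epsilon> a
    by (rule derivative_eq_intros deriv[OF that] refl)+ (simp add: Q_def algebra_simps)
  have H0: "(H \<longlongrightarrow> 0) at_top"
  proof (rule Lim_null_comparison)
    show "eventually (\<lambda>a. norm (H a) \<le> C * a powr (- 1/2)) at_top"
      using eventually_ge_at_top[of A] by eventually_elim (use H in simp)
    have "((\<lambda>a::real. a powr (- (1/2))) \<longlongrightarrow> 0) at_top"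
      by (rule tendsto_neg_powr) (auto simp: filterlim_ident)
    then show "((\<lambda>a. C * a powr (- 1/2)) \<longlongrightarrow> 0) at_top"
      using tendsto_mult_right_zero by force
  qed
  have WI: "((\<lambda>a. exp (- \<epsilon> * a\<^sup>2) * g a - Q \<epsilon> a) has_integral - (exp (- \<epsilon> * A\<^sup>2) * H A)) {A..}" if "\<epsilon> \<ge> 0" for \<epsilon>
  proof (rule has_integral_FTC_to_inf)
    show "((\<lambda>a. exp (- \<epsilon> * a\<^sup>2) * H a) \<longlongrightarrow> 0) at_top"
      by (rule Lim_null_comparison[OF _ tendsto_norm_zero[OF H0]])
         (use that in \<open>auto intro!: always_eventually mult_left_le_one_le simp: abs_mult\<close>)
  qed (rule W)
  \<comment> \<open>The first part of \<open>Q\<close> carries \<epsilon> * a * a^(-1/2) =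
    (\<epsilon> * a^2) * a^(-3/2), and \<epsilon> * a^2 is absorbed by the Gaussian. The constant is
    2 from this part plus 1 from \<open>R\<close>.\<close>
  have Qb: "norm (Q \<epsilon> a) \<le> 3 * C * a powr (- 3/2)" if "\<epsilon> \<ge> 0" "a \<in> {A..}" for \<epsilon> a
  proof -
    have a: "a \<ge> A" "a > 0" using that A by auto
    let ?E = "exp (- \<epsilon> * a\<^sup>2)"
    have "a * a powr (- 1/2) = a\<^sup>2 * a powr (- 3/2)"
      using a(2) by (simp add: powr_mult_base power2_eq_square mult.assoc)
    then have "\<bar>2 * \<epsilon> * a * ?E * H a\<bar> \<le> 2 * (\<epsilon> * a\<^sup>2 * ?E) * (C * a powr (- 3/2))"
    proof -
      have "\<bar>2 * \<epsilon> * a * ?E * H a\<bar> = 2 * \<epsilon> * a * ?E * \<bar>H a\<bar>"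
        using that a by (simp add: abs_mult)
      also have "\<dots> \<le> 2 * \<epsilon> * a * ?E * (C * a powr (- 1/2))"
        using that a by (intro mult_left_mono H) auto
      also have "\<dots> = 2 * \<epsilon> * ?E * C * (a * a powr (- 1/2))" by (simp only: mult_ac)
      also have "\<dots> = 2 * \<epsilon> * ?E * C * (a\<^sup>2 * a powr (- 3/2))" by (simp only: \<open>a * a powr (- 1/2) = a\<^sup>2 * a powr (- 3/2)\<close>)
      finally show ?thesis by (simp only: mult_ac)
    qed
    also have "\<dots> \<le> 2 * 1 * (C * a powr (- 3/2))"
    proof (intro mult_right_mono mult_left_mono)
      have "\<epsilon> * a\<^sup>2 \<le> exp (\<epsilon> * a\<^sup>2)" using exp_ge_add_one_self[of "\<epsilon> * a\<^sup>2"] by linarith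
      then show "\<epsilon> * a\<^sup>2 * ?E \<le> 1" by (simp add: exp_minus field_simps)
    qed (use C in auto)
    finally have 1: "\<bar>2 * \<epsilon> * a * ?E * H a\<bar> \<le> 2 * (C * a powr (- 3/2))" by simp
    have "\<bar>?E * R a\<bar> \<le> 1 * (C * a powr (- 3/2))"
      unfolding abs_mult using that a by (intro mult_mono R) auto
    with 1 show ?thesis unfolding Q_def real_norm_def by linarith
  qed
  have dom: "(\<lambda>a. 3 * C * a powr (- 3/2)) integrable_on {A..}"
    using has_integral_powr_to_inf[of "- 3/2" A] A
    by (intro integrable_on_mult_right) (auto simp: integrable_on_def)
  have QI: "Q \<epsilon> integrable_on {A..}" if "\<epsilon> \<ge> 0" for \<epsilon>
  proof -
    have "Q \<epsilon> absolutely_integrable_on {A..}"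
      using Qb[OF that]
      by (intro measurable_bounded_by_integrable_imp_absolutely_integrable[OF _ _ dom]
          continuous_imp_measurable_on_sets_lebesgue)
         (auto simp: Q_def intro!: continuous_intros contH cont)
    then show ?thesis by (rule set_lebesgue_integral_eq_integral)
  qed
  \<comment> \<open>The value \<epsilon> = 0 is included on purpose: the same formula then also
    gives the improper integral of \<open>g\<close> itself.\<close>
  have gI: "((\<lambda>a. exp (- \<epsilon> * a\<^sup>2) * g a) has_integral integral {A..} (Q \<epsilon>) - exp (- \<epsilon> * A\<^sup>2) * H A) {A..}"
    if "\<epsilon> \<ge> 0" for \<epsilon>
    using has_integral_add[OF WI[OF that] integrable_integral[OF QI[OF that]]] by simp
  have Q0: "((\<lambda>\<epsilon>. integral {A..} (Q \<epsilon>)) \<longlongrightarrow> integral {A..} (Q 0)) (at_right 0)"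
  proof (rule dominated_convergence_at_right[OF _ dom])
    fix a
    show "((\<lambda>\<epsilon>. Q \<epsilon> a) \<longlongrightarrow> Q 0 a) (at_right 0)"
      unfolding Q_def by (intro tendsto_intros)
  qed (use QI Qb in auto)
  show ?thesis
  proof (rule that)
    show "(g has_integral integral {A..} (Q 0) - H A) {A..}" using gI[of 0] by simp
    show "(\<lambda>a. exp (- \<epsilon> * a\<^sup>2) * g a) integrable_on {A..}" if "\<epsilon> > 0" for \<epsilon>
      using gI[of \<epsilon>] that by (auto simp: integrable_on_def)
    have "((\<lambda>\<epsilon>. integral {A..} (Q \<epsilon>) - exp (- \<epsilon> * A\<^sup>2) * H A) \<longlongrightarrow> integral {A..} (Q 0) - H A) (at_right 0)"
      by (intro tendsto_diff Q0 gaussian_factor_tendsto)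
    then show "((\<lambda>\<epsilon>. integral {A..} (\<lambda>a. exp (- \<epsilon> * a\<^sup>2) * g a)) \<longlongrightarrow> integral {A..} (Q 0) - H A) (at_right 0)"
    proof (rule Lim_transform_eventually)
      show "\<forall>\<^sub>F \<epsilon> in at_right 0. integral {A..} (Q \<epsilon>) - exp (- \<epsilon> * A\<^sup>2) * H A = integral {A..} (\<lambda>a. exp (- \<epsilon> * a\<^sup>2) * g a)"
        using eventually_at_right_less[of 0] by eventually_elim (rule sym, rule integral_unique, rule gI, simp)
    qed
  qed
qed

lemma has_integral_gaussian_abel_from_0:
  fixes g :: "real \<Rightarrow> real"
  assumes A: "A \<ge> 0" and meas: "g \<in> borel_measurable borel"
    and bound: "\<And>a. a \<in> {0..A} \<Longrightarrow> \<bar>g a\<bar> \<le> C"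
    and tail: "(g has_integral L) {A..}"
      "\<And>\<epsilon>. \<epsilon> > 0 \<Longrightarrow> (\<lambda>a. exp (- \<epsilon> * a\<^sup>2) * g a) integrable_on {A..}"
      "((\<lambda>\<epsilon>. integral {A..} (\<lambda>a. exp (- \<epsilon> * a\<^sup>2) * g a)) \<longlongrightarrow> L) (at_right 0)"
  obtains L' where "(g has_integral L') {0..}"
    "((\<lambda>\<epsilon>. integral {0..} (\<lambda>a. exp (- \<epsilon> * a\<^sup>2) * g a)) \<longlongrightarrow> L') (at_right 0)"
proof -
  have un: "{0..A} \<union> {A..} = {0..}" and int: "{0..A} \<inter> {A..} = {A}" using A by auto
  have C: "(\<lambda>a. C) integrable_on {0..A}" by (rule integrable_const_ivl)
  have le: "norm (exp (- \<epsilon> * a\<^sup>2) * g a) \<le> C" if "\<epsilon> \<ge> 0" "a \<in> {0..A}" for \<epsilon> a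
  proof -
    have "norm (exp (- \<epsilon> * a\<^sup>2) * g a) \<le> 1 * \<bar>g a\<bar>"
      unfolding norm_mult using that by (intro mult_mono) auto
    also have "\<dots> \<le> C" using bound[OF that(2)] by simp
    finally show ?thesis .
  qed
  have I: "(\<lambda>a. exp (- \<epsilon> * a\<^sup>2) * g a) integrable_on {0..A}" if "\<epsilon> \<ge> 0" for \<epsilon>
  proof -
    have "(\<lambda>a. exp (- \<epsilon> * a\<^sup>2) * g a) absolutely_integrable_on {0..A}"
    proof (rule measurable_bounded_by_integrable_imp_absolutely_integrable[OF _ _ C le[OF that]])
      show "(\<lambda>a. exp (- \<epsilon> * a\<^sup>2) * g a) \<in> borel_measurable (lebesgue_on {0..A})"
        using meas by (intro borel_measurable_lebesgue_onI) measurable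
    qed auto
    then show ?thesis by (rule set_lebesgue_integral_eq_integral)
  qed
  have lim: "((\<lambda>\<epsilon>. integral {0..A} (\<lambda>a. exp (- \<epsilon> * a\<^sup>2) * g a)) \<longlongrightarrow> integral {0..A} g) (at_right 0)"
    by (rule dominated_convergence_at_right[OF _ C le gaussian_factor_tendsto]) (use I in auto)
  have comb: "(k has_integral (i + j)) {0..}" if "(k has_integral i) {0..A}" "(k has_integral j) {A..}" for k :: "real \<Rightarrow> real" and i j
    using has_integral_Un[OF that, unfolded un int] by simp
  show ?thesis
  proof (rule that)
    show "(g has_integral (integral {0..A} g + L)) {0..}"
      using I[of 0] by (intro comb tail integrable_integral) simp
    have "((\<lambda>\<epsilon>. integral {0..A} (\<lambda>a. exp (- \<epsilon> * a\<^sup>2) * g a) + integral {A..} (\<lambda>a. exp (- \<epsilon> * a\<^sup>2) * g a))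
        \<longlongrightarrow> integral {0..A} g + L) (at_right 0)"
      by (intro tendsto_add lim tail)
    then show "((\<lambda>\<epsilon>. integral {0..} (\<lambda>a. exp (- \<epsilon> * a\<^sup>2) * g a)) \<longlongrightarrow> integral {0..A} g + L) (at_right 0)"
    proof (rule Lim_transform_eventually)
      show "\<forall>\<^sub>F \<epsilon> in at_right 0. integral {0..A} (\<lambda>a. exp (- \<epsilon> * a\<^sup>2) * g a) + integral {A..} (\<lambda>a. exp (- \<epsilon> * a\<^sup>2) * g a)
          = integral {0..} (\<lambda>a. exp (- \<epsilon> * a\<^sup>2) * g a)"
        using eventually_at_right_less[of 0]
        by eventually_elim (rule sym, rule integral_unique, intro comb integrable_integral I tail, auto)
    qed
  qed
qed

text \<open>The integrand is of size a^(1/2) with phase a^2. Each integration by parts gains a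
  factor 1/a: after one the integrand is still of size a^(-1/2), after two it is a^(-3/2), which is
  absolutely integrable. The boundary terms are O(a^(-1/2)) and vanish at infinity.\<close>

lemma bessel_product_improper:
  fixes \<nu> r :: real
  assumes \<nu>: "\<nu> \<ge> - 1/4" and r: "r > 0"
  defines "g \<equiv> (\<lambda>a. bessel_kernel \<nu> a * bessel_red (2 * \<nu>) ((a * r / 2)\<^sup>2))"
  obtains L where "(g has_integral L) {0..}"
    "((\<lambda>\<epsilon>. integral {0..} (\<lambda>a. exp (- \<epsilon> * a\<^sup>2) * g a)) \<longlongrightarrow> L) (at_right 0)"
proof -
  have mu: "\<nu> - 1/2 \<ge> - 3/4" and nu2: "2 * \<nu> \<ge> - 3/4" using \<nu> by simp_all
  define c1 where "c1 = 1/4 - (\<nu> - 1/2)\<^sup>2"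
  define c2 where "c2 = 1/4 - (2 * \<nu>)\<^sup>2"
  define u where "u = (\<lambda>a. bessel_u (\<nu> - 1/2) (a\<^sup>2))"
  define v where "v = (\<lambda>a. bessel_u' (\<nu> - 1/2) (a\<^sup>2))"
  define s where "s = (\<lambda>a. bessel_u (2 * \<nu>) (a * r))"
  define w where "w = (\<lambda>a. bessel_u' (2 * \<nu>) (a * r))"
  \<comment> \<open>Up to a constant, \<open>j\<close> is the Bessel function of order 2 \<nu> at a
    * r. The functions \<open>j1\<close> and \<open>j2\<close> are its first two derivatives, with
    the derivative of \<open>w\<close> eliminated by Bessel's equation.\<close>
  define j where "j = (\<lambda>a. a powr (- 1/2) * s a)"
  define j1 where "j1 = (\<lambda>a. a powr (- 1/2) * (r * w a - s a / (2 * a)))"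
  define j2 where "j2 = (\<lambda>a. a powr (- 1/2) * (3/4 * s a / a\<^sup>2 - (r\<^sup>2 + c2 / a\<^sup>2) * s a - r * w a / a))"
  \<comment> \<open>Up to the factor \<open>\<kappa>\<close>, \<open>g\<close> is \<open>a * j * u\<close> where \<open>u\<close> oscillates like \<open>cos (a\<^sup>2)\<close>. Bessel's equation gives
    \<open>a * u = - v' / 2 - c1 * u / a\<^sup>3\<close>, and \<open>H\<close> collects the boundary terms of integrating first \<open>j * v'\<close>
    and then \<open>j1 * v = j1 / (2 * a) * u'\<close> by parts.\<close>
  define H where "H = (\<lambda>a. (j1 a / (2 * a) * u a - j a * v a) / 2)"
  define R where "R = (\<lambda>a. c1 * j a * u a / a ^ 3 + (j2 a / (2 * a) - j1 a / (2 * a\<^sup>2)) * u a / 2)"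
  define \<kappa> where "\<kappa> = r powr - (2 * \<nu> + 1/2)"
  have \<kappa>: "\<kappa> > 0" using r by (simp add: \<kappa>_def)

  have du: "(u has_real_derivative 2 * a * v a) (at a)" if "a > 0" for a
  proof -
    have "((\<lambda>a::real. a\<^sup>2) has_real_derivative 2 * a) (at a)" by (auto intro!: derivative_eq_intros)
    from DERIV_chain2[OF bessel_u_deriv[OF mu] this] that show ?thesis
      by (simp add: u_def v_def mult_ac)
  qed
  have dv: "(v has_real_derivative - 2 * a * (1 + c1 / a ^ 4) * u a) (at a)" if "a > 0" for a
  proof -
    have "((\<lambda>a::real. a\<^sup>2) has_real_derivative 2 * a) (at a)" by (auto intro!: derivative_eq_intros)
    moreover have "a\<^sup>2 > 0" using that by simp
    from DERIV_chain2[OF bessel_u'_deriv[OF mu this, folded c1_def] calculation] show ?thesis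
      unfolding v_def u_def by (rule DERIV_cong) (simp add: power_mult[symmetric] algebra_simps)
  qed
  have ds: "(s has_real_derivative r * w a) (at a)" if "a > 0" for a
  proof -
    have "((\<lambda>a. a * r) has_real_derivative r) (at a)" by (auto intro!: derivative_eq_intros)
    from DERIV_chain2[OF bessel_u_deriv[OF nu2] this] that r show ?thesis
      by (simp add: s_def w_def mult_ac)
  qed
  have dw: "(w has_real_derivative - r * (1 + c2 / (a * r)\<^sup>2) * s a) (at a)" if "a > 0" for a
  proof -
    have "((\<lambda>a. a * r) has_real_derivative r) (at a)" by (auto intro!: derivative_eq_intros)
    moreover have "a * r > 0" using that r by simp
    from DERIV_chain2[OF bessel_u'_deriv[OF nu2 this, folded c2_def] calculation] show ?thesis
      unfolding w_def s_def by (rule DERIV_cong) (simp add: algebra_simps)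
  qed
  have dp: "((\<lambda>a. a powr (- 1/2)) has_real_derivative (- 1/2) * a powr (- 1/2) / a) (at a)" if "a > 0" for a :: real
    by (rule powr_has_field_derivative_self[OF that])
  have dj: "(j has_real_derivative j1 a) (at a)" if "a > 0" for a
    unfolding j_def using DERIV_mult[OF dp[OF that] ds[OF that]]
    by (rule DERIV_cong) (use that in \<open>simp add: j1_def field_simps\<close>)
  have dj1: "(j1 has_real_derivative j2 a) (at a)" if "a > 0" for a
  proof -
    have "((\<lambda>a. r * w a - s a / (2 * a)) has_real_derivative
       r * (- r * (1 + c2 / (a * r)\<^sup>2) * s a) - (r * w a * (2 * a) - s a * 2) / ((2 * a) * (2 * a))) (at a)"
      using that by (auto intro!: derivative_eq_intros ds dw)
    from DERIV_mult[OF dp[OF that] this] show ?thesis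
      unfolding j1_def
    proof (rule DERIV_cong)
      show "- 1 / 2 * a powr (- 1 / 2) / a * (r * w a - s a / (2 * a)) +
          (r * (- r * (1 + c2 / (a * r)\<^sup>2) * s a) - (r * w a * (2 * a) - s a * 2) / (2 * a * (2 * a))) * a powr (- 1 / 2) = j2 a"
        using that r unfolding j2_def by (simp add: divide_simps power2_eq_square) (simp add: algebra_simps)
    qed
  qed
  have dH: "(H has_real_derivative a * j a * u a + R a) (at a)" if "a > 0" for a
  proof -
    have "(H has_real_derivative (((j2 a * (2 * a) - j1 a * 2) / ((2 * a) * (2 * a))) * u a + 2 * a * v a * (j1 a / (2 * a))
        - (j1 a * v a + - 2 * a * (1 + c1 / a ^ 4) * u a * j a)) / 2) (at a)"
    proof -
      have "((\<lambda>a. j1 a / (2 * a)) has_real_derivative (j2 a * (2 * a) - j1 a * 2) / ((2 * a) * (2 * a))) (at a)"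
        using that by (intro DERIV_divide dj1 DERIV_cmult_Id) auto
      from DERIV_cdivide[OF DERIV_diff[OF DERIV_mult[OF this du[OF that]] DERIV_mult[OF dj[OF that] dv[OF that]]], of 2]
      show ?thesis unfolding H_def .
    qed
    then show ?thesis
      by (rule DERIV_cong) (use that in \<open>simp add: R_def divide_simps power2_eq_square power3_eq_cube power4_eq_xxxx; simp add: algebra_simps\<close>)
  qed

  obtain C1 where C1: "C1 > 0" "\<And>t. t \<ge> 1 \<Longrightarrow> \<bar>bessel_u (\<nu> - 1/2) t\<bar> \<le> C1" "\<And>t. t \<ge> 1 \<Longrightarrow> \<bar>bessel_u' (\<nu> - 1/2) t\<bar> \<le> C1"
    using bessel_u_bounded[OF mu] by metis
  obtain C2 where C2: "C2 > 0" "\<And>t. t \<ge> 1 \<Longrightarrow> \<bar>bessel_u (2 * \<nu>) t\<bar> \<le> C2" "\<And>t. t \<ge> 1 \<Longrightarrow> \<bar>bessel_u' (2 * \<nu>) t\<bar> \<le> C2"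
    using bessel_u_bounded[OF nu2] by metis
  \<comment> \<open>From here on both Bessel arguments, a^2 and a * r, are at least 1, the range of
    the energy bound.\<close>
  define A where "A = max 1 (1 / r)"
  have A: "A \<ge> 1" by (simp add: A_def)
  have A0: "a > 0" "a \<ge> 1" "a\<^sup>2 \<ge> 1" "a * r \<ge> 1" if "a \<ge> A" for a
  proof -
    show "a \<ge> 1" using that A by simp
    then show "a > 0" "a\<^sup>2 \<ge> 1" by simp_all
    have "1 / r \<le> a" using that by (simp add: A_def)
    then show "a * r \<ge> 1" using r by (simp add: field_simps)
  qed
  have bu: "\<bar>u a\<bar> \<le> C1" "\<bar>v a\<bar> \<le> C1" "\<bar>s a\<bar> \<le> C2" "\<bar>w a\<bar> \<le> C2" if "a \<ge> A" for a
    using A0[OF that] C1 C2 by (simp_all add: u_def v_def s_def w_def)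
  \<comment> \<open>Large enough to bound the brackets of \<open>j\<close>, \<open>j1\<close> and
    \<open>j2\<close> simultaneously, term by term.\<close>
  define D where "D = C2 * (r\<^sup>2 + \<bar>c2\<bar> + r + 2)"
  have D: "D > 0" using C2(1) r unfolding D_def by (intro mult_pos_pos) (auto intro!: add_nonneg_pos add_nonneg_nonneg)
  have div_le: "\<bar>y / z\<bar> \<le> B" if "\<bar>y\<bar> \<le> B" "z \<ge> 1" for y z B :: real
  proof -
    have "\<bar>y / z\<bar> \<le> \<bar>y\<bar> / 1" unfolding abs_divide using that by (intro divide_left_mono) auto
    with that(1) show ?thesis by simp
  qed
  have bj: "\<bar>j a\<bar> \<le> a powr (- 1/2) * D" "\<bar>j1 a\<bar> \<le> a powr (- 1/2) * D" "\<bar>j2 a\<bar> \<le> a powr (- 1/2) * D" if "a \<ge> A" for a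
  proof -
    note b = bu[OF that] and a = A0[OF that]
    have x0: "0 \<le> C2 * r\<^sup>2" "0 \<le> C2 * \<bar>c2\<bar>" "0 \<le> C2 * r" using C2(1) r by auto
    have D': "D = C2 * r\<^sup>2 + C2 * \<bar>c2\<bar> + C2 * r + 2 * C2" by (simp add: D_def algebra_simps)
    have 1: "\<bar>r * w a\<bar> \<le> C2 * r" "\<bar>r\<^sup>2 * s a\<bar> \<le> C2 * r\<^sup>2" "\<bar>c2 * s a\<bar> \<le> C2 * \<bar>c2\<bar>"
    proof -
      have m: "\<bar>y * z\<bar> \<le> C2 * \<bar>y\<bar>" if "\<bar>z\<bar> \<le> C2" for y z
        using mult_left_mono[OF that, of "\<bar>y\<bar>"] by (simp add: abs_mult mult.commute)
      show "\<bar>r * w a\<bar> \<le> C2 * r" "\<bar>r\<^sup>2 * s a\<bar> \<le> C2 * r\<^sup>2" "\<bar>c2 * s a\<bar> \<le> C2 * \<bar>c2\<bar>"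
        using m[OF b(4), of r] m[OF b(3), of "r\<^sup>2"] m[OF b(3), of c2] r by simp_all
    qed
    have 2: "\<bar>s a / (2 * a)\<bar> \<le> C2" "\<bar>s a / a\<^sup>2\<bar> \<le> C2" "\<bar>r * w a / a\<bar> \<le> C2 * r" "\<bar>c2 * s a / a\<^sup>2\<bar> \<le> C2 * \<bar>c2\<bar>"
      using a by (intro div_le b 1; simp)+
    have "\<bar>s a\<bar> \<le> D" using b(3) x0 C2(1) unfolding D' by linarith
    then show "\<bar>j a\<bar> \<le> a powr (- 1/2) * D" by (simp add: j_def abs_mult mult_left_mono)
    have "\<bar>r * w a - s a / (2 * a)\<bar> \<le> C2 * r + C2"
      by (rule order_trans[OF abs_triangle_ineq4 add_mono[OF 1(1) 2(1)]])
    also have "\<dots> \<le> D" using x0 C2(1) unfolding D' by linarith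
    finally have "\<bar>r * w a - s a / (2 * a)\<bar> \<le> D" .
    then show "\<bar>j1 a\<bar> \<le> a powr (- 1/2) * D" by (simp add: j1_def abs_mult mult_left_mono)
    have tri: "\<bar>3/4 * p - q - t - z\<bar> \<le> P + Q + T + Z"
      if "\<bar>p\<bar> \<le> P" "\<bar>q\<bar> \<le> Q" "\<bar>t\<bar> \<le> T" "\<bar>z\<bar> \<le> Z" for p q t z P Q T Z :: real
      using that by linarith
    have "3/4 * s a / a\<^sup>2 - (r\<^sup>2 + c2 / a\<^sup>2) * s a - r * w a / a = 3/4 * (s a / a\<^sup>2) - r\<^sup>2 * s a - c2 * s a / a\<^sup>2 - r * w a / a"
      by (simp add: algebra_simps)
    also have "\<bar>\<dots>\<bar> \<le> C2 + C2 * r\<^sup>2 + C2 * \<bar>c2\<bar> + C2 * r"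
      by (intro tri 1 2)
    also have "\<dots> \<le> D" using C2(1) by (simp add: D')
    finally have "\<bar>3/4 * s a / a\<^sup>2 - (r\<^sup>2 + c2 / a\<^sup>2) * s a - r * w a / a\<bar> \<le> D" .
    then show "\<bar>j2 a\<bar> \<le> a powr (- 1/2) * D" by (simp add: j2_def abs_mult mult_left_mono)
  qed
  \<comment> \<open>One constant for both \<open>H\<close> and \<open>R\<close>; the summand |c1|
    accounts for the perturbation term of Bessel's equation in \<open>R\<close>.\<close>
  define C where "C = \<kappa> * (D * C1 * (\<bar>c1\<bar> + 1))"
  have bH: "\<bar>\<kappa> * H a\<bar> \<le> C * a powr (- 1/2)" if "a \<ge> A" for a
  proof -
    note b = bu[OF that] and a = A0[OF that] and bj = bj[OF that]
    let ?P = "a powr (- 1/2) * D * C1"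
    have P: "?P \<ge> 0" using D C1(1) by simp
    have "\<bar>j1 a * u a\<bar> \<le> ?P" "\<bar>j a * v a\<bar> \<le> ?P"
      unfolding abs_mult by (intro mult_mono' bj b abs_ge_zero)+
    note ju = this
    have "\<bar>j1 a * u a / (2 * a)\<bar> \<le> ?P" using a by (intro div_le ju) auto
    then have "\<bar>j1 a / (2 * a) * u a\<bar> \<le> ?P" by simp
    moreover have half: "\<bar>(p - q) / 2\<bar> \<le> B" if "\<bar>p\<bar> \<le> B" "\<bar>q\<bar> \<le> B" for p q B :: real
      using that unfolding abs_le_iff by (auto simp: field_simps)
    ultimately have "\<bar>H a\<bar> \<le> ?P" unfolding H_def by (intro half ju)
    also have "\<dots> \<le> ?P * (\<bar>c1\<bar> + 1)" using mult_left_mono[OF _ P, of 1 "\<bar>c1\<bar> + 1"] by simp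
    finally show ?thesis using \<kappa> by (simp add: C_def abs_mult mult_ac)
  qed
  have bR: "\<bar>\<kappa> * R a\<bar> \<le> C * a powr (- 3/2)" if "a \<ge> A" for a
  proof -
    note b = bu[OF that] and a = A0[OF that] and bj = bj[OF that]
    let ?P = "a powr (- 1/2) * D * C1"
    have P: "?P \<ge> 0" using D C1(1) by simp
    have 1: "\<bar>j a * u a\<bar> \<le> ?P" "\<bar>j1 a * u a\<bar> \<le> ?P" "\<bar>j2 a * u a\<bar> \<le> ?P"
      unfolding abs_mult by (intro mult_mono' bj b abs_ge_zero)+
    have "\<bar>c1 * (j a * u a)\<bar> \<le> \<bar>c1\<bar> * ?P"
      unfolding abs_mult[of c1] using 1(1) by (intro mult_left_mono) auto
    then have 2: "\<bar>c1 * (j a * u a) / a\<^sup>2\<bar> \<le> \<bar>c1\<bar> * ?P" using a by (intro div_le) auto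
    have 3: "\<bar>j1 a * u a / a\<bar> \<le> ?P" using a 1 by (intro div_le) auto
    have tri: "\<bar>p + (q - t) / 4\<bar> \<le> B' + B" if "\<bar>p\<bar> \<le> B'" "\<bar>q\<bar> \<le> B" "\<bar>t\<bar> \<le> B" for p q t B B' :: real
      using that unfolding abs_le_iff by (auto simp: field_simps)
    have "a * R a = c1 * (j a * u a) / a\<^sup>2 + (j2 a * u a - j1 a * u a / a) / 4"
      using a unfolding R_def by (simp add: field_simps power2_eq_square power3_eq_cube)
    also have "\<bar>\<dots>\<bar> \<le> \<bar>c1\<bar> * ?P + ?P" by (intro tri 1 2 3)
    finally have "\<bar>a * R a\<bar> \<le> \<bar>c1\<bar> * ?P + ?P" .
    then have "\<bar>R a\<bar> \<le> (\<bar>c1\<bar> + 1) * ?P / a" using a by (simp add: abs_mult field_simps)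
    moreover have "a powr (- 3/2) = a powr (- 1/2) / a"
      using a powr_diff[of a "- 1/2" 1] by simp
    ultimately have "\<bar>R a\<bar> \<le> D * C1 * (\<bar>c1\<bar> + 1) * a powr (- 3/2)" by (simp add: mult_ac)
    then show ?thesis using \<kappa> by (simp add: C_def abs_mult mult.assoc)
  qed
  have geq: "g a = \<kappa> * (a * j a * u a)" if "a > 0" for a
  proof -
    have "bessel_red (2 * \<nu>) ((a * r / 2)\<^sup>2) = (a * r) powr - (2 * \<nu> + 1/2) * s a"
      using that r by (simp add: s_def bessel_u_def power_divide mult.assoc[symmetric] powr_add[symmetric])
    also have "(a * r) powr - (2 * \<nu> + 1/2) = a powr - (2 * \<nu> + 1/2) * \<kappa>"
      using that r by (simp add: powr_mult \<kappa>_def)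
    finally have 1: "bessel_red (2 * \<nu>) ((a * r / 2)\<^sup>2) = a powr - (2 * \<nu> + 1/2) * \<kappa> * s a" .
    have 2: "a powr (2 * \<nu> + 1) * a powr - (2 * \<nu> + 1/2) = a * a powr (- 1/2)"
      using that by (simp add: powr_add[symmetric] powr_mult_base)
    have "g a = (a powr (2 * \<nu> + 1) * a powr - (2 * \<nu> + 1/2)) * \<kappa> * s a * u a"
      unfolding g_def bessel_kernel_conv_bessel_u[OF that] 1 u_def by (simp only: mult_ac)
    then show ?thesis unfolding 2 j_def by (simp only: mult_ac)
  qed
  have contR: "continuous_on {A..} (\<lambda>a. \<kappa> * R a)"
  proof -
    have nz: "a \<noteq> 0" if "a \<in> {A..}" for a using A0[of a] that by auto
    have ct: "continuous_on {A..} f" if "\<And>a. a > 0 \<Longrightarrow> (f has_real_derivative f' a) (at a)" for f f' :: "real \<Rightarrow> real"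
    proof (rule DERIV_continuous_on)
      fix a assume "a \<in> {A..}"
      then have "a > 0" using A0(1) by simp
      then show "(f has_real_derivative f' a) (at a within {A..})"
        by (rule has_field_derivative_at_within[OF that])
    qed
    note cts = ct[OF du] ct[OF ds] ct[OF dw] ct[OF dj] ct[OF dj1] ct[OF dp]
    show ?thesis unfolding R_def j2_def
      by (intro continuous_intros cts) (use nz in auto)
  qed
  have dg: "((\<lambda>a. \<kappa> * H a) has_real_derivative g a + \<kappa> * R a) (at a)" if "a \<ge> A" for a
    using DERIV_cmult[OF dH[OF A0(1)[OF that]], of \<kappa>] by (simp only: geq[OF A0(1)[OF that]] distrib_left)
  obtain L where L: "(g has_integral L) {A..}"
    "\<And>\<epsilon>. \<epsilon> > 0 \<Longrightarrow> (\<lambda>a. exp (- \<epsilon> * a\<^sup>2) * g a) integrable_on {A..}"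
    "((\<lambda>\<epsilon>. integral {A..} (\<lambda>a. exp (- \<epsilon> * a\<^sup>2) * g a)) \<longlongrightarrow> L) (at_right 0)"
    by (rule has_integral_improper_gaussian_abel[OF A _ _ _ contR],
        rule dg, assumption, rule bH, assumption, rule bR, assumption, rule that)
  have "subgaussian (\<lambda>a. complex_of_real (g a))"
  proof -
    have "bessel_J_entire (of_real (2 * \<nu>)) (of_real a * of_real r) = of_real (bessel_red (2 * \<nu>) ((a * r / 2)\<^sup>2))" for a
      unfolding of_real_mult[symmetric, of a r] by (rule bessel_J_entire_of_real[OF nu2])
    then show ?thesis
      using bessel_product_subgaussian[OF \<nu>, of "of_real r"] by (simp add: g_def)
  qed
  then have meas: "(\<lambda>a. complex_of_real (g a)) \<in> borel_measurable borel"
    and "\<exists>C. \<forall>a\<ge>0. norm (complex_of_real (g a)) \<le> C * exp (1 * a\<^sup>2)"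
    unfolding subgaussian_def using zero_less_one by blast+
  then obtain C' where C': "\<And>a. a \<ge> 0 \<Longrightarrow> \<bar>g a\<bar> \<le> C' * exp (a\<^sup>2)" by auto
  have gm: "g \<in> borel_measurable borel"
    using measurable_comp[OF meas, of Re] by (simp add: o_def)
  have "\<bar>g a\<bar> \<le> \<bar>C'\<bar> * exp (A\<^sup>2)" if "a \<in> {0..A}" for a
  proof -
    have "\<bar>g a\<bar> \<le> C' * exp (a\<^sup>2)" using that by (intro C') simp
    also have "\<dots> \<le> \<bar>C'\<bar> * exp (A\<^sup>2)" using that by (intro mult_mono) auto
    finally show ?thesis .
  qed
  note bounded = this
  show ?thesis
    by (rule has_integral_gaussian_abel_from_0[OF _ gm _ L],
        use A in simp, rule bounded, assumption, assumption, rule that)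
qed

section \<open>Powers and branches: from the single-valued factors back to Bessel functions\<close>

lemma bessel_integrand_eq:
  fixes \<nu> a :: real and x :: complex
  assumes "\<nu> \<ge> - 1/4" and x: "x \<noteq> 0" and a: "a \<ge> 0"
  shows "of_real (a ^ 2) * bessel_J (of_real (2 * \<nu>)) (of_real a * x) * bessel_J (of_real (\<nu> - 1 / 2)) (of_real (a ^ 2))
     = exp (of_real (2 * \<nu>) * (Ln x - Ln 2) + of_real ((1/2 - \<nu>) * ln 2)) *
       (of_real (bessel_kernel \<nu> a) * bessel_J_entire (of_real (2 * \<nu>)) (of_real a * x))"
proof (cases "a = 0")
  \<comment> \<open>The left-hand side vanishes through a^2, the right-hand side because
    \<open>0 powr\<close> any exponent is 0, also for \<nu> = -1/4, where the exponent 4 \<nu> + 1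
    is 0.\<close>
  case True
  then show ?thesis by (simp add: bessel_kernel_def)
next
  case False
  with a have a: "a > 0" by simp
  have 1: "bessel_J (of_real (2 * \<nu>)) (of_real a * x)
     = of_real (a powr (2 * \<nu>)) * exp (of_real (2 * \<nu>) * (Ln x - Ln 2)) * bessel_J_entire (of_real (2 * \<nu>)) (of_real a * x)"
  proof -
    have ne: "of_real a * x \<noteq> 0" using a x by simp
    \<comment> \<open>Scaling by a > 0 does not change the argument, so the branch of the power is
      the same along the whole ray.\<close>
    have "Ln (of_real a * x) = of_real (ln a) + Ln x"
      using Ln_times_of_real[OF a x] Ln_of_real[OF a] by simp
    then have "of_real (2 * \<nu>) * (Ln (of_real a * x) - Ln 2) = of_real (2 * \<nu> * ln a) + of_real (2 * \<nu>) * (Ln x - Ln 2)"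
      by (simp add: algebra_simps)
    then have "exp (of_real (2 * \<nu>) * (Ln (of_real a * x) - Ln 2)) = of_real (a powr (2 * \<nu>)) * exp (of_real (2 * \<nu>) * (Ln x - Ln 2))"
      using a by (simp only: exp_add exp_of_real) (simp add: powr_def)
    then show ?thesis
      unfolding bessel_J_eq_log[OF ne] bessel_J_log_def using ne by (simp add: exp_Ln)
  qed
  have 2: "bessel_J (of_real (\<nu> - 1 / 2)) (of_real (a ^ 2))
     = of_real (a powr (2 * \<nu> - 1) * exp ((1/2 - \<nu>) * ln 2) * bessel_red (\<nu> - 1/2) ((a\<^sup>2 / 2)\<^sup>2))"
  proof -
    have "a\<^sup>2 = a powr 2" using a by simp
    then have "(a\<^sup>2) powr (\<nu> - 1/2) = a powr (2 * \<nu> - 1)"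
      by (simp only: powr_powr) (simp add: algebra_simps)
    moreover have "2 powr (\<nu> - 1/2) * exp ((1/2 - \<nu>) * ln 2) = (1::real)"
      by (simp add: powr_def mult_exp_exp left_diff_distrib)
    ultimately have pw: "(a\<^sup>2 / 2) powr (\<nu> - 1/2) = a powr (2 * \<nu> - 1) * exp ((1/2 - \<nu>) * ln 2)"
      by (simp add: powr_divide divide_simps mult_ac)
    have "complex_of_real (a\<^sup>2) / 2 = of_real (a\<^sup>2 / 2)" by simp
    then have "(complex_of_real (a\<^sup>2) / 2) powr of_real (\<nu> - 1/2) = of_real ((a\<^sup>2 / 2) powr (\<nu> - 1/2))"
      by (simp only:) (rule powr_of_real, simp)
    moreover have "bessel_J_entire (of_real (\<nu> - 1/2)) (of_real (a\<^sup>2)) = of_real (bessel_red (\<nu> - 1/2) ((a\<^sup>2 / 2)\<^sup>2))"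
      by (rule bessel_J_entire_of_real) (use assms in simp)
    ultimately show ?thesis
      using a unfolding bessel_J_def pw by (simp only: of_real_mult) simp
  qed
  have 3: "a ^ 2 * a powr (2 * \<nu>) * a powr (2 * \<nu> - 1) = a powr (4 * \<nu> + 1)"
  proof -
    have "a ^ 2 = a powr 2" using a by simp
    then show ?thesis by (simp only: powr_add[symmetric]) (simp add: algebra_simps)
  qed
  have "of_real (bessel_kernel \<nu> a) = complex_of_real (a ^ 2) * of_real (a powr (2 * \<nu>)) * of_real (a powr (2 * \<nu> - 1)) * of_real (bessel_red (\<nu> - 1/2) ((a\<^sup>2 / 2)\<^sup>2))"
    unfolding bessel_kernel_def 3[symmetric] by (simp only: of_real_mult)
  then show ?thesis
    unfolding 1 2 exp_add exp_of_real by (simp only: of_real_mult mult_ac)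
qed

text \<open>The power x^(2 \<nu> + 1) arises with the logarithm of x, so it is the power \<nu> + 1/2
  of x^2 with logarithm 2 Ln x. Keeping this logarithm unreduced makes the identity valid for every
  nonzero x.\<close>

lemma bessel_value_eq:
  fixes \<nu> :: real and x :: complex
  assumes x: "x \<noteq> 0"
  shows "exp (of_real (2 * \<nu>) * (Ln x - Ln 2) + of_real ((1/2 - \<nu>) * ln 2)) * (x\<^sup>2 / 16 * bessel_J_entire (of_real (\<nu> + 1/2)) (x\<^sup>2 / 4))
     = x / 4 * bessel_J_log (of_real (\<nu> + 1 / 2)) (2 * Ln x - Ln 4)"
proof -
  have l2: "Ln 2 = complex_of_real (ln 2)" using Ln_of_real[of 2] by simp
  have "ln (4::real) = 2 * ln 2" using ln_realpow[of 2 2] by simp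
  then have l4: "Ln 4 = 2 * complex_of_real (ln 2)" using Ln_of_real[of 4] by simp
  have "exp (2 * Ln x - Ln 4) = x\<^sup>2 / 4"
    using x by (simp add: exp_diff exp_double)
  moreover have "exp (of_real (\<nu> + 1/2) * (2 * Ln x - Ln 4 - Ln 2)) = exp (of_real (2 * \<nu>) * (Ln x - Ln 2) + of_real ((1/2 - \<nu>) * ln 2)) * (x / 4)"
  proof -
    have "of_real (\<nu> + 1/2) * (2 * Ln x - Ln 4 - Ln 2) = (of_real (2 * \<nu>) * (Ln x - Ln 2) + of_real ((1/2 - \<nu>) * ln 2)) + (Ln x - Ln 4)"
      unfolding l2 l4 by (simp add: field_simps)
    moreover have "exp (Ln x - Ln 4) = x / 4" using x by (simp add: exp_diff)
    ultimately show ?thesis by (simp only: exp_add)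
  qed
  ultimately show ?thesis
    unfolding bessel_J_log_def by (simp only:) (simp add: power2_eq_square)
qed

text \<open>For Re x > 0 the argument of x lies strictly between -pi/2 and pi/2, so doubling it
  stays inside the principal range.\<close>

lemma bessel_J_log_square:
  assumes "Re x > 0"
  shows "bessel_J_log \<mu> (2 * Ln x - Ln 4) = bessel_J \<mu> (x\<^sup>2 / 4)"
proof -
  have x: "x \<noteq> 0" using assms by auto
  have e: "exp (2 * Ln x - Ln 4) = x\<^sup>2 / 4" using x by (simp add: exp_diff exp_double)
  have "\<bar>Im (Ln x)\<bar> < pi / 2" using assms x Re_Ln_pos_lt by blast
  moreover have "Im (Ln (4::complex)) = 0" using Ln_of_real[of 4] by simp
  ultimately have "Ln (exp (2 * Ln x - Ln 4)) = 2 * Ln x - Ln 4"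
    by (intro Ln_exp) auto
  then show ?thesis using bessel_J_eq_log[of "x\<^sup>2 / 4" \<mu>] x by (simp add: e)
qed

lemma has_Abel_integral_bessel:
  fixes \<nu> :: real and x :: complex
  defines "f \<equiv> (\<lambda>a. of_real (a ^ 2) * bessel_J (of_real (2 * \<nu>)) (of_real a * x) * bessel_J (of_real (\<nu> - 1 / 2)) (of_real (a ^ 2)))"
  assumes \<nu>: "\<nu> \<ge> - 1/4" and x: "x \<noteq> 0"
  shows "has_Abel_integral f (x / 4 * bessel_J_log (of_real (\<nu> + 1 / 2)) (2 * Ln x - Ln 4))"
proof -
  define Q where "Q = exp (of_real (2 * \<nu>) * (Ln x - Ln 2) + of_real ((1/2 - \<nu>) * ln 2))"
  let ?b = "\<lambda>a. of_real (bessel_kernel \<nu> a) * bessel_J_entire (of_real (2 * \<nu>)) (of_real a * x)"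
  have eq: "of_real (exp (- \<epsilon> * a ^ 2)) * f a = Q * (exp (- of_real \<epsilon> * of_real (a\<^sup>2)) * ?b a)" if "a \<in> {0..}" for \<epsilon> a
  proof -
    have "f a = Q * ?b a" unfolding f_def Q_def
      by (rule bessel_integrand_eq[OF \<nu> x]) (use that in simp)
    moreover have "complex_of_real (exp (- \<epsilon> * a ^ 2)) = exp (- of_real \<epsilon> * of_real (a\<^sup>2))"
      unfolding exp_of_real[symmetric] by simp
    ultimately show ?thesis by (simp only: mult.left_commute)
  qed
  show ?thesis
    unfolding has_Abel_integral_def
  proof (intro conjI allI impI)
    fix \<epsilon> :: real assume "\<epsilon> > 0"
    then have "(\<lambda>a. Q * (exp (- of_real \<epsilon> * of_real (a\<^sup>2)) * ?b a)) absolutely_integrable_on {0..}"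
      by (intro set_integrable_mult_right subgaussian_absolutely_integrable bessel_product_subgaussian \<nu>) simp
    then show "(\<lambda>a. of_real (exp (- \<epsilon> * a ^ 2)) * f a) absolutely_integrable_on {0..}"
      by (subst set_integrable_cong[OF refl refl eq]) auto
  next
    have "((\<lambda>\<epsilon>. Q * integral {0..} (\<lambda>a. exp (- of_real \<epsilon> * of_real (a\<^sup>2)) * ?b a))
       \<longlongrightarrow> Q * (x\<^sup>2 / 16 * bessel_J_entire (of_real (\<nu> + 1/2)) (x\<^sup>2 / 4))) (at_right 0)"
      using bessel_product_abel_limit[OF \<nu>, of x] unfolding bessel_product_abel_value[OF \<nu>]
      by (intro tendsto_mult_left)
    moreover have "integral {0..} (\<lambda>a. of_real (exp (- \<epsilon> * a ^ 2)) * f a) = Q * integral {0..} (\<lambda>a. exp (- of_real \<epsilon> * of_real (a\<^sup>2)) * ?b a)" for \<epsilon>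
      unfolding integral_mult_right[symmetric] by (rule integral_cong[OF eq])
    ultimately show "((\<lambda>\<epsilon>. integral {0..} (\<lambda>a. of_real (exp (- \<epsilon> * a ^ 2)) * f a))
       \<longlongrightarrow> x / 4 * bessel_J_log (of_real (\<nu> + 1 / 2)) (2 * Ln x - Ln 4)) (at_right 0)"
      unfolding Q_def bessel_value_eq[OF x] by (simp only:)
  qed
qed

text \<open>The three clauses reflect convergence and branches. For real x the integral exists as a
  gauge integral; for non-real x the exponential growth calls for Abel summation. When Re x <= 0,
  doubling the argument of x can leave the principal range, so the value is taken on the Riemann
  surface of the logarithm.\<close>

theorem theorem21:
  fixes \<nu> :: real and x :: complex and f :: "real \<Rightarrow> complex"
  defines "f \<equiv> (\<lambda>a. of_real (a ^ 2) * bessel_J (of_real (2 * \<nu>)) (of_real a * x)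
                      * bessel_J (of_real (\<nu> - 1 / 2)) (of_real (a ^ 2)))"
  assumes "\<nu> \<ge> - 1 / 4" and "x \<notin> \<real>\<^sub>\<le>\<^sub>0"
  shows "(x \<in> \<real> \<longrightarrow>
            (f has_integral x / 4 * bessel_J (of_real (\<nu> + 1 / 2)) (x ^ 2 / 4)) {0..}) \<and>
         (Re x > 0 \<longrightarrow>
            has_Abel_integral f (x / 4 * bessel_J (of_real (\<nu> + 1 / 2)) (x ^ 2 / 4))) \<and>
         has_Abel_integral f (x / 4 * bessel_J_log (of_real (\<nu> + 1 / 2)) (2 * Ln x - Ln 4))"
proof -
  have \<nu>: "\<nu> \<ge> - 1/4" using assms(2) by simp
  have x: "x \<noteq> 0" using assms(3) by auto
  have log: "has_Abel_integral f (x / 4 * bessel_J_log (of_real (\<nu> + 1 / 2)) (2 * Ln x - Ln 4))"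
    unfolding f_def by (rule has_Abel_integral_bessel[OF \<nu> x])
  then have right: "has_Abel_integral f (x / 4 * bessel_J (of_real (\<nu> + 1 / 2)) (x ^ 2 / 4))" if "Re x > 0"
    unfolding bessel_J_log_square[OF that] .
  have "(f has_integral x / 4 * bessel_J (of_real (\<nu> + 1 / 2)) (x ^ 2 / 4)) {0..}" if real: "x \<in> \<real>"
  proof -
    from real obtain r where xr: "x = of_real r" by (auto elim: Reals_cases)
    with assms(3) have r: "r > 0" by (auto simp: not_le)
    define Q where "Q = exp (of_real (2 * \<nu>) * (Ln x - Ln 2) + of_real ((1/2 - \<nu>) * ln 2))"
    define g where "g = (\<lambda>a. bessel_kernel \<nu> a * bessel_red (2 * \<nu>) ((a * r / 2)\<^sup>2))"
    obtain L where L: "(g has_integral L) {0..}"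
      "((\<lambda>\<epsilon>. integral {0..} (\<lambda>a. exp (- \<epsilon> * a\<^sup>2) * g a)) \<longlongrightarrow> L) (at_right 0)"
      by (rule bessel_product_improper[OF \<nu> r], rule that[unfolded g_def])
    have fg: "f a = Q * of_real (g a)" if "a \<in> {0..}" for a
    proof -
      have "bessel_J_entire (of_real (2 * \<nu>)) (of_real a * x) = of_real (bessel_red (2 * \<nu>) ((a * r / 2)\<^sup>2))"
        unfolding xr of_real_mult[symmetric, of a r] by (rule bessel_J_entire_of_real) (use \<nu> in simp)
      then show ?thesis
        unfolding f_def using bessel_integrand_eq[OF \<nu> x, of a] that by (simp add: Q_def g_def)
    qed
    have "((\<lambda>a. Q * of_real (g a)) has_integral Q * of_real L) {0..}"
      using has_integral_linear[OF L(1) bounded_linear_of_real[where 'a = complex]]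
      by (intro has_integral_mult_right) (simp add: o_def)
    then have fL: "(f has_integral Q * of_real L) {0..}"
      by (rule has_integral_eq[rotated]) (simp add: fg)
    have abel: "has_Abel_integral f (x / 4 * bessel_J (of_real (\<nu> + 1 / 2)) (x ^ 2 / 4))"
      by (rule right) (simp add: xr r)
    have Q0: "Q \<noteq> 0" by (simp add: Q_def)
    \<comment> \<open>The regularised real integrals of \<open>g\<close> are recovered from the
      complex ones of \<open>f\<close> by dividing by the nonzero constant \<open>Q\<close> and
      taking real parts.\<close>
    have int: "integral {0..} (\<lambda>a. of_real (exp (- \<epsilon> * a ^ 2)) * f a) = Q * of_real (integral {0..} (\<lambda>a. exp (- \<epsilon> * a\<^sup>2) * g a))"
      if "\<epsilon> > 0" for \<epsilon>
    proof -
      have "(\<lambda>a. of_real (exp (- \<epsilon> * a ^ 2)) * f a) integrable_on {0..}"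
        using abel that unfolding has_Abel_integral_def by (blast intro: set_lebesgue_integral_eq_integral(1))
      then have "(\<lambda>a. of_real (exp (- \<epsilon> * a ^ 2) * g a) * Q) integrable_on {0..}"
        by (rule integrable_eq) (simp add: fg)
      then have "(\<lambda>a. inverse Q * (of_real (exp (- \<epsilon> * a ^ 2) * g a) * Q)) integrable_on {0..}"
        by (rule integrable_on_mult_right)
      then have "(\<lambda>a. complex_of_real (exp (- \<epsilon> * a ^ 2) * g a)) integrable_on {0..}"
        by (rule integrable_eq) (simp add: Q0)
      from integrable_linear[OF this bounded_linear_Re]
      have "(\<lambda>a. exp (- \<epsilon> * a ^ 2) * g a) integrable_on {0..}" by (simp add: o_def)
      from has_integral_linear[OF integrable_integral[OF this] bounded_linear_of_real[where 'a = complex]]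
      have "((\<lambda>a. Q * of_real (exp (- \<epsilon> * a ^ 2) * g a)) has_integral Q * of_real (integral {0..} (\<lambda>a. exp (- \<epsilon> * a\<^sup>2) * g a))) {0..}"
        by (intro has_integral_mult_right) (simp add: o_def)
      then have "((\<lambda>a. of_real (exp (- \<epsilon> * a ^ 2)) * f a) has_integral Q * of_real (integral {0..} (\<lambda>a. exp (- \<epsilon> * a\<^sup>2) * g a))) {0..}"
        by (rule has_integral_eq[rotated]) (simp add: fg mult_ac)
      then show ?thesis by (rule integral_unique)
    qed
    have "((\<lambda>\<epsilon>. Q * of_real (integral {0..} (\<lambda>a. exp (- \<epsilon> * a\<^sup>2) * g a))) \<longlongrightarrow> Q * of_real L) (at_right 0)"
      by (intro tendsto_mult_left tendsto_of_real L(2))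
    then have "((\<lambda>\<epsilon>. integral {0..} (\<lambda>a. of_real (exp (- \<epsilon> * a ^ 2)) * f a)) \<longlongrightarrow> Q * of_real L) (at_right 0)"
      by (rule Lim_transform_eventually)
         (use eventually_at_right_less[of 0] in eventually_elim, rule int[symmetric])
    moreover note abel[unfolded has_Abel_integral_def, THEN conjunct2]
    \<comment> \<open>Both sides are limits of the same regularised integrals, so the improper
      integral has the value already computed by Abel summation.\<close>
    ultimately have "Q * of_real L = x / 4 * bessel_J (of_real (\<nu> + 1 / 2)) (x ^ 2 / 4)"
      by (rule tendsto_unique[rotated]) simp
    with fL show ?thesis by simp
  qed
  with right log show ?thesis by blast
qed

end
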